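(* Let $E=K(n,m,\mathcal D)$ be a Bedford-McMullen carpet of non-doubling type, assume that $a_0>a_{m-1}$, and let $0<\rho<n^{-3}$. Let $\overline\Delta$ be the upper doubling index with respect to $\varphi(r)=\log|\log r|$. Then for $\mu_E$-a.e. $z\in E$, $$\overline\Delta(z;\mu_E,\rho)=-\log_{p_0}(a_0/a_{m-1}),$$ where $p_0=a_0/\#\mathcal D$.
   Context: Let $n>m\ge 2$ be integers and let $\mathcal D\subset\{0,\dots,n-1\}\times\{0,\dots,m-1\}$ be nonempty. For $\mathbf d\in\mathcal D$ let $S_{\mathbf d}(z)=\mathrm{diag}(n^{-1},m^{-1})(z+\mathbf d)$ on $\mathbb R^2$. The Bedford-McMullen carpet $E=K(n,m,\mathcal D)$ is the unique nonempty compact set with $E=\bigcup_{\mathbf d\in\mathcal D}S_{\mathbf d}(E)$, a metric space with the Euclidean distance. Its uniform Bernoulli measure $\mu_E$ is the unique Borel probability measure supported on $E$ with $\mu_E=\frac1{\#\mathcal D}\sum_{\mathbf d\in\mathcal D}\mu_E\circ S_{\mathbf d}^{-1}$. The fiber sequence is $a_j=\#\{i:(i,j)\in\mathcal D\}$, $0\le j\le m-1$. $B_r(x)$ denotes the open ball. A Borel probability measure $\mu$ is doubling if $\sup_{x\in\mathrm{supp}\,\mu,\ r>0}\mu(B_{2r}(x))/\mu(B_r(x))<\infty$. $E$ is of non-doubling type if $\mu_E$ is not doubling. (Known, due to Li-Wei-Wen: this holds if and only if $a_0a_{m-1}>0$, $a_0\ne a_{m-1}$, and $a_ja_{j+1}>0$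 for some $0\le j\le m-2$.) For a measure $\mu$ on a metric space $X$ (here $X=E$), $0<\rho<1$ and $z\in X$, $$\overline\Delta(z;\mu,\rho)=\limsup_{r\to0}\ \sup_{z'\in X:\ B_{\rho r}(z')\subset B_r(z)}\frac{\log[\mu(B_r(z))/\mu(B_{\rho r}(z'))]}{\log|\log r|}$$ (only small $r$, for which $\log|\log r|>0$, matter). $\log_b x=\log x/\log b$. *)

theory Defs
  imports "HOL-Probability.Probability"
begin

definition carpet_map :: "nat \<Rightarrow> nat \<Rightarrow> nat \<times> nat \<Rightarrow> real \<times> real \<Rightarrow> real \<times> real" where
  "carpet_map n m d z =
     ((fst z + real (fst d)) / real n, (snd z + real (snd d)) / real m)"

definition carpet :: "nat \<Rightarrow> nat \<Rightarrow> (nat \<times> nat) set \<Rightarrow> (real \<times> real) set" where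
  "carpet n m D =
     (THE E. E \<noteq> {} \<and> compact E \<and> E = (\<Union>d\<in>D. carpet_map n m d ` E))"

definition measure_support :: "'a::metric_space measure \<Rightarrow> 'a set" where
  "measure_support M = {x. \<forall>r>0. emeasure M (ball x r) > 0}"

text \<open>The measure lives on the Borel sets of the whole plane, which is where the
  preimages under the maps of the iterated function system are taken.\<close>

definition carpet_measure :: "nat \<Rightarrow> nat \<Rightarrow> (nat \<times> nat) set \<Rightarrow> (real \<times> real) measure" where
  "carpet_measure n m D =
     (THE M. prob_space M \<and> sets M = sets borel \<and>
        measure_support M \<subseteq> carpet n m D \<and>
        (\<forall>A\<in>sets borel. measure M A =
           (1 / real (card D)) * (\<Sum>d\<in>D. measure M (carpet_map n m d -` A))))"

definition fiber :: "(nat \<times> nat) set \<Rightarrow> nat \<Rightarrow> nat" where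
  "fiber D j = card {i. (i, j) \<in> D}"

definition doubling_measure :: "'a::metric_space measure \<Rightarrow> bool" where
  "doubling_measure M \<longleftrightarrow>
     (SUP (x, r) \<in> measure_support M \<times> {0<..}.
        emeasure M (ball x (2 * r)) / emeasure M (ball x r)) < \<infinity>"

definition non_doubling_type :: "nat \<Rightarrow> nat \<Rightarrow> (nat \<times> nat) set \<Rightarrow> bool" where
  "non_doubling_type n m D \<longleftrightarrow> \<not> doubling_measure (carpet_measure n m D)"

text \<open>The upper doubling index of a finite measure on the metric space \<open>X\<close>, a subset of the
  ambient type with the induced distance: all balls, including those in the inclusion
  constraint, are balls of \<open>X\<close>. The quotient is taken in the reals, so the definition is
  meant for measures that are positive on every ball of \<open>X\<close> (as for a carpet and its
  uniform Bernoulli measure). The supremum and the upper limit are taken in the extended reals.\<close>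

definition upper_doubling_index ::
  "(real \<Rightarrow> real) \<Rightarrow> 'a::metric_space set \<Rightarrow> 'a measure \<Rightarrow> real \<Rightarrow> 'a \<Rightarrow> ereal" where
  "upper_doubling_index \<phi> X M \<rho> z =
     Limsup (at_right 0) (\<lambda>r.
       SUP z' \<in> {z' \<in> X. X \<inter> ball z' (\<rho> * r) \<subseteq> X \<inter> ball z r}.
         ereal (ln (measure M (X \<inter> ball z r) / measure M (X \<inter> ball z' (\<rho> * r))) / \<phi> r))"

end

theory Submission
  imports Defs "HOL-Real_Asymp.Real_Asymp"
begin

text \<open>Write \<open>a j = fiber D j\<close> and code the points of the carpet by sequences of digits in \<open>D\<close>; the
  measure is then the image of the Bernoulli measure. A ball of radius about \<open>m ^ -k \<approx> n ^ -l\<close> is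
  covered by boundedly many approximate squares, which fix the first \<open>k\<close> row digits and the
  first \<open>l\<close> column digits and have mass \<open>(\<Prod>t\<in>{l..<k}. a (j t)) / card D ^ k\<close>. Squares in the same
  row have the same mass. Rows \<open>k\<close> digits deep are adjacent only through a carry: the two words end
  in \<open>j (m-1) ... (m-1)\<close> and \<open>(j+1) 0 ... 0\<close>, and after a run of length \<open>q\<close> the two masses differ by
  the factor \<open>(a 0 / a (m-1)) ^ q\<close>, up to a constant. Hence the doubling constant of a point at scale
  \<open>m ^ -k\<close> is governed by the run of zeros (or of digits \<open>m-1\<close>, which is less likely) ending at
  position \<open>k\<close> of its row expansion. By the Borel-Cantelli lemmas, for almost every point the
  longest such run is asymptotic to \<open>ln k / ln (card D / a 0)\<close>, where \<open>k\<close> is comparable to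
  \<open>\<bar>ln r\<bar>\<close>. If \<open>a (m-1) = 0\<close> or there are no adjacent nonempty rows then no run contributes and
  the measure is doubling.\<close>

section \<open>Expansions in an integer base\<close>

text \<open>The mass of a square depends only on the row digits in the window from \<open>l\<close>
  to \<open>k\<close>, whose length is about \<open>k * (1 - ln m / ln n)\<close>. Runs are only
  logarithmic in \<open>k\<close>, so in the lower bound the relevant run eventually lies inside the
  window and each of its digits contributes a full factor \<open>a 0 / a (m-1)\<close>. All other
  losses (the number of covering squares, the rounding of \<open>r\<close> to powers of
  \<open>m\<close> and \<open>n\<close>, the dependence on \<rho>) are bounded and vanish after
  division by \<open>ln \<bar>ln r\<bar>\<close>. Only run lengths must be known sharply, and the
  index is the constant for run lengths times the logarithm of the gain per digit. The condition on
  \<rho> serves the lower bound: the small ball must stay out of the heavy row across the carry and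
  yet lie in a large ball that straddles the boundary. Since the carpet and its measure are given by
  definite descriptions, symbolic coordinates become available only after two uniqueness
  proofs.\<close>

definition expansion :: "nat \<Rightarrow> (nat \<Rightarrow> nat) \<Rightarrow> real" where
  "expansion b f = (\<Sum>t. real (f t) / real b ^ Suc t)"

primrec word_value :: "nat \<Rightarrow> (nat \<Rightarrow> nat) \<Rightarrow> nat \<Rightarrow> nat" where
  "word_value b f 0 = 0"
| "word_value b f (Suc k) = b * word_value b f k + f k"

lemma sums_top_digit:
  assumes "2 \<le> b"
  shows "(\<lambda>t. real (b - 1) / real b ^ Suc t) sums 1"
proof -
  have 1: "(\<lambda>t. (real (b - 1) / real b) * (1 / real b) ^ t) sums
      ((real (b - 1) / real b) * (1 / (1 - 1 / real b)))"
    using assms by (intro sums_mult geometric_sums) auto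
  have 2: "(real (b - 1) / real b) * (1 / (1 - 1 / real b)) = 1"
    using assms by (simp add: field_simps of_nat_diff)
  have 3: "(real (b - 1) / real b) * (1 / real b) ^ t = real (b - 1) / real b ^ Suc t" for t
    by (simp add: power_divide)
  show ?thesis using 1 unfolding 2 3 .
qed

lemma expansion_term_le:
  assumes "2 \<le> b" "f t < b"
  shows "real (f t) / real b ^ Suc t \<le> real (b - 1) / real b ^ Suc t"
  using assms by (intro divide_right_mono) auto

lemma summable_expansion:
  assumes "2 \<le> b" "\<And>t. f t < b"
  shows "summable (\<lambda>t. real (f t) / real b ^ Suc t)"
proof (rule summable_comparison_test[OF _ sums_summable[OF sums_top_digit[OF assms(1)]]], intro exI allI impI)
  show "norm (real (f t) / real b ^ Suc t) \<le> real (b - 1) / real b ^ Suc t" for t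
    using expansion_term_le[of b f t] assms by auto
qed

lemma expansion_nonneg:
  assumes "2 \<le> b" "\<And>t. f t < b"
  shows "0 \<le> expansion b f"
  unfolding expansion_def by (rule suminf_nonneg[OF summable_expansion[OF assms]]) simp_all

lemma expansion_le_1:
  assumes "2 \<le> b" "\<And>t. f t < b"
  shows "expansion b f \<le> 1"
proof -
  have "expansion b f \<le> (\<Sum>t. real (b - 1) / real b ^ Suc t)"
    unfolding expansion_def
    by (rule suminf_le[OF _ summable_expansion[of b f, OF assms]
          sums_summable[OF sums_top_digit[OF assms(1)]]])
      (rule expansion_term_le[of b f, OF assms])
  also have "\<dots> = 1" using sums_unique[OF sums_top_digit[OF assms(1)]] by simp
  finally show ?thesis .
qed

lemma expansion_top: "2 \<le> b \<Longrightarrow> expansion b (\<lambda>t. b - 1) = 1"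
  using sums_unique[OF sums_top_digit] by (simp add: expansion_def)

lemma expansion_less_1:
  assumes "2 \<le> b" "\<And>t. f t < b" "f s \<noteq> b - 1"
  shows "expansion b f < 1"
proof -
  have lt: "f s < b - 1" using assms(2)[of s] assms(3) by linarith
  let ?g = "\<lambda>t. real (b - 1) / real b ^ Suc t - real (f t) / real b ^ Suc t"
  have "0 < (\<Sum>t. ?g t)"
  proof (rule suminf_pos2[where i = s])
    show "summable ?g"
      by (rule summable_diff[OF sums_summable[OF sums_top_digit[OF assms(1)]]
            summable_expansion[OF assms(1,2)]])
    show "0 \<le> ?g t" for t using expansion_term_le[of b f t, OF assms(1,2)] by simp
    have "real (f s) / real b ^ Suc s < real (b - 1) / real b ^ Suc s"
      using lt assms by (intro divide_strict_right_mono) auto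
    then show "0 < ?g s" by simp
  qed
  also have "(\<Sum>t. ?g t) = 1 - expansion b f"
    unfolding expansion_def
    using suminf_diff[OF sums_summable[OF sums_top_digit[OF assms(1)]] summable_expansion[OF assms(1,2)]]
      sums_unique[OF sums_top_digit[OF assms(1)]] by simp
  finally show ?thesis by simp
qed

lemma expansion_Suc:
  assumes "2 \<le> b" "\<And>t. f t < b"
  shows "expansion b f = (real (f 0) + expansion b (\<lambda>t. f (Suc t))) / real b"
proof -
  have "expansion b f = real (f 0) / real b + (\<Sum>t. real (f (Suc t)) / real b ^ Suc (Suc t))"
    unfolding expansion_def using suminf_split_head[OF summable_expansion[of b f, OF assms]] by simp
  also have "(\<Sum>t. real (f (Suc t)) / real b ^ Suc (Suc t))
      = (\<Sum>t. real (f (Suc t)) / real b ^ Suc t / real b)"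
    by (simp add: field_simps)
  also have "\<dots> = expansion b (\<lambda>t. f (Suc t)) / real b"
    unfolding expansion_def
    using summable_expansion[of b "\<lambda>t. f (Suc t)"] assms by (intro suminf_divide) auto
  finally show ?thesis by (simp add: add_divide_distrib)
qed

text \<open>Scaling by \<open>b ^ k\<close> separates the integer formed by the first
  \<open>k\<close> digits from a tail in the closed unit interval. This turns estimates on
  coordinates into statements about integers.\<close>

lemma expansion_split:
  assumes "2 \<le> b" "\<And>t. f t < b"
  shows "real b ^ k * expansion b f = real (word_value b f k) + expansion b (\<lambda>t. f (k + t))"
proof (induction k)
  case (Suc k)
  have "expansion b (\<lambda>t. f (k + t)) = (real (f k) + expansion b (\<lambda>t. f (Suc k + t))) / real b"
    using expansion_Suc[of b "\<lambda>t. f (k + t)"] assms by simp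
  with Suc show ?case using assms by (simp add: field_simps)
qed simp

lemma expansion_bounds:
  assumes "2 \<le> b" "\<And>t. f t < b"
  shows "real (word_value b f k) \<le> real b ^ k * expansion b f"
    and "real b ^ k * expansion b f \<le> real (word_value b f k) + 1"
  using expansion_split[of b f k, OF assms] expansion_nonneg[of b "\<lambda>t. f (k + t)", OF assms(1,2)]
    expansion_le_1[of b "\<lambda>t. f (k + t)", OF assms(1,2)] by linarith+

lemma word_value_cong:
  "(\<And>t. t < k \<Longrightarrow> f t = g t) \<Longrightarrow> word_value b f k = word_value b g k"
  by (induction k) auto

lemma word_value_eqD:
  assumes "word_value b f k = word_value b g k" "\<And>t. f t < b" "\<And>t. g t < b" "t < k"
  shows "f t = g t"
  using assms(1,4)
proof (induction k)
  case (Suc k)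
  have "(b * word_value b f k + f k) mod b = f k" "(b * word_value b g k + g k) mod b = g k"
    using assms(2,3) by auto
  with Suc.prems(1) have *: "f k = g k" by (metis word_value.simps(2))
  with Suc.prems(1) assms(2)[of k] have "word_value b f k = word_value b g k" by auto
  with Suc * show ?case by (cases "t = k") auto
qed simp

lemma expansion_dist_le:
  assumes "2 \<le> b" "\<And>t. f t < b" "\<And>t. g t < b" "\<And>t. t < k \<Longrightarrow> f t = g t"
  shows "\<bar>expansion b f - expansion b g\<bar> \<le> 1 / real b ^ k"
proof -
  have "word_value b f k = word_value b g k" using assms(4) by (rule word_value_cong)
  then have "\<bar>real b ^ k * expansion b f - real b ^ k * expansion b g\<bar> \<le> 1"
    using expansion_bounds[of b f k, OF assms(1,2)] expansion_bounds[of b g k, OF assms(1,3)] by linarith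
  moreover have "real b ^ k * expansion b f - real b ^ k * expansion b g
      = real b ^ k * (expansion b f - expansion b g)" by (simp add: algebra_simps)
  ultimately have "real b ^ k * \<bar>expansion b f - expansion b g\<bar> \<le> 1"
    by (simp add: abs_mult)
  then show ?thesis using assms(1) by (simp add: field_simps)
qed

text \<open>The scaled numbers differ by less than 1, and each is its word plus a tail in
  \<open>[0, 1]\<close>, so the words differ by less than 2. The strict bound on the distance
  excludes a difference of exactly 2.\<close>

lemma word_value_diff_le:
  assumes "2 \<le> b" "\<And>t. f t < b" "\<And>t. g t < b"
    and "\<bar>expansion b f - expansion b g\<bar> < r" "r \<le> 1 / real b ^ k"
  shows "\<bar>int (word_value b f k) - int (word_value b g k)\<bar> \<le> 1"
proof -
  have "\<bar>expansion b f - expansion b g\<bar> * real b ^ k < r * real b ^ k"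
    using assms(1,4) by (intro mult_strict_right_mono) auto
  also have "\<dots> \<le> 1" using assms(1,5) by (simp add: field_simps)
  finally have "\<bar>expansion b f - expansion b g\<bar> * real b ^ k < 1" .
  moreover have "real b ^ k * expansion b f - real b ^ k * expansion b g
      = (expansion b f - expansion b g) * real b ^ k" by (simp add: algebra_simps)
  ultimately have "\<bar>real b ^ k * expansion b f - real b ^ k * expansion b g\<bar> < 1"
    by (simp add: abs_mult)
  with expansion_bounds[of b f k, OF assms(1,2)] expansion_bounds[of b g k, OF assms(1,3)]
  have "\<bar>real (word_value b f k) - real (word_value b g k)\<bar> < 2" by linarith
  then show ?thesis by linarith
qed

text \<open>A carry, read from the last digit backwards. Reduction modulo \<open>b\<close> shows
  that either the last digit itself is increased and the prefixes agree, or \<open>b - 1\<close>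
  turns into \<open>0\<close> and the same question arises one digit earlier.\<close>

lemma word_value_Suc_eqD:
  assumes "word_value b g k = Suc (word_value b f k)" "\<And>t. f t < b" "\<And>t. g t < b"
  obtains p where "p < k" "\<And>t. t < p \<Longrightarrow> f t = g t" "g p = Suc (f p)"
    "\<And>t. p < t \<Longrightarrow> t < k \<Longrightarrow> f t = b - 1 \<and> g t = 0"
proof -
  from assms(1) have "\<exists>p<k. (\<forall>t<p. f t = g t) \<and> g p = Suc (f p) \<and>
      (\<forall>t. p < t \<and> t < k \<longrightarrow> f t = b - 1 \<and> g t = 0)"
  proof (induction k)
    case (Suc k)
    let ?F = "word_value b f k" and ?G = "word_value b g k"
    have eq: "b * ?G + g k = b * ?F + Suc (f k)" using Suc.prems by simp
    show ?case
    proof (cases "Suc (f k) < b")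
      case True
      have "(b * ?G + g k) mod b = g k" "(b * ?F + Suc (f k)) mod b = Suc (f k)"
        using assms(3) True by auto
      with eq have *: "g k = Suc (f k)" by simp
      with eq have "?F = ?G" using assms(2)[of k] by auto
      then have "\<forall>t<k. f t = g t" using word_value_eqD[of b f k g] assms by blast
      with * show ?thesis by (intro exI[of _ k]) auto
    next
      case False
      with assms(2)[of k] have fk: "Suc (f k) = b" by linarith
      then have eq': "b * ?G + g k = b * Suc ?F" using eq by simp
      then have "(b * ?G + g k) mod b = 0" by simp
      with assms(3)[of k] have gk: "g k = 0" by simp
      with eq' have "b * ?G = b * Suc ?F" by simp
      then have "?G = Suc ?F" using fk by (metis mult_cancel1 nat.distinct(1))
      from Suc.IH[OF this] obtain p where "p < k" "\<forall>t<p. f t = g t" "g p = Suc (f p)"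
        "\<forall>t. p < t \<and> t < k \<longrightarrow> f t = b - 1 \<and> g t = 0" by blast
      then show ?thesis using fk gk
        by (intro exI[of _ p]) (auto simp: less_Suc_eq)
    qed
  qed simp
  then show ?thesis using that by blast
qed

text \<open>For a number with two expansions the floor selects the one that ends in zeros, and it
  depends measurably on \<open>y\<close>.\<close>

definition floor_digit :: "nat \<Rightarrow> real \<Rightarrow> nat \<Rightarrow> nat" where
  "floor_digit b y t = nat (\<lfloor>real b ^ Suc t * y\<rfloor> mod int b)"

lemma floor_digit_expansion:
  assumes "2 \<le> b" "\<And>t. f t < b" "\<And>k. \<exists>t\<ge>k. f t \<noteq> b - 1"
  shows "floor_digit b (expansion b f) t = f t"
proof -
  obtain s where "s \<ge> Suc t" "f s \<noteq> b - 1" using assms(3) by blast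
  then have "expansion b (\<lambda>u. f (Suc t + u)) < 1"
    using assms by (intro expansion_less_1[where s = "s - Suc t"]) auto
  with expansion_nonneg[of b "\<lambda>u. f (Suc t + u)", OF assms(1,2)]
  have "\<lfloor>real b ^ Suc t * expansion b f\<rfloor> = int (word_value b f (Suc t))"
    unfolding expansion_split[of b f, OF assms(1,2)] floor_eq_iff of_int_of_nat_eq by linarith
  then show ?thesis using assms(2)[of t] unfolding floor_digit_def
    by (metis mod_less mod_mult_self4 nat_int word_value.simps(2) zmod_int)
qed

text \<open>A tail of top digits has value exactly 1. It carries into the word before it, so the
  floor reads zeros.\<close>

lemma floor_digit_expansion_top:
  assumes "2 \<le> b" "\<And>t. f t < b" "\<And>t. k \<le> t \<Longrightarrow> f t = b - 1" "k \<le> t"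
  shows "floor_digit b (expansion b f) t = 0"
proof -
  have "real b ^ Suc t * expansion b f = real (word_value b f (Suc t)) + 1"
    unfolding expansion_split[of b f, OF assms(1,2)]
    using assms expansion_top[of b] by simp
  moreover have "\<lfloor>real (word_value b f (Suc t)) + 1\<rfloor> = int (word_value b f (Suc t) + 1)"
    by linarith
  ultimately have "\<lfloor>real b ^ Suc t * expansion b f\<rfloor> = int (word_value b f (Suc t) + 1)" by metis
  moreover have "(word_value b f (Suc t) + 1) mod b = 0"
    using assms by simp
  ultimately show ?thesis unfolding floor_digit_def by (metis nat_int of_nat_0 zmod_int)
qed

section \<open>The carpet and its measure in symbolic coordinates\<close>

locale bedford_mcmullen =
  fixes n m :: nat and D :: "(nat \<times> nat) set"
  assumes two_le_m: "2 \<le> m" and m_less_n: "m < n"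
    and D_subset: "D \<subseteq> {0..<n} \<times> {0..<m}" and D_nonempty: "D \<noteq> {}"
begin

lemma finite_D [simp]: "finite D"
  using D_subset by (rule finite_subset) simp

lemma card_D_pos: "0 < card D"
  using D_nonempty by (simp add: card_gt_0_iff)

lemma two_le_n: "2 \<le> n"
  using two_le_m m_less_n by simp

definition Omega :: "(nat \<Rightarrow> nat \<times> nat) set" where
  "Omega = {w. \<forall>t. w t \<in> D}"

definition code :: "(nat \<Rightarrow> nat \<times> nat) \<Rightarrow> real \<times> real" where
  "code w = (expansion n (\<lambda>t. fst (w t)), expansion m (\<lambda>t. snd (w t)))"

lemma OmegaD: "w \<in> Omega \<Longrightarrow> w t \<in> D"
  by (simp add: Omega_def)

lemma fst_less: "w \<in> Omega \<Longrightarrow> fst (w t) < n"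
  using D_subset OmegaD[of w t] by auto

lemma snd_less: "w \<in> Omega \<Longrightarrow> snd (w t) < m"
  using D_subset OmegaD[of w t] by auto

lemma case_nat_Omega: "d \<in> D \<Longrightarrow> w \<in> Omega \<Longrightarrow> case_nat d w \<in> Omega"
  by (auto simp: Omega_def split: nat.split)

lemma Omega_nonempty: "Omega \<noteq> {}"
proof -
  obtain d where "d \<in> D" using D_nonempty by blast
  then have "(\<lambda>t. d) \<in> Omega" by (simp add: Omega_def)
  then show ?thesis by blast
qed

lemma code_Suc:
  assumes "w \<in> Omega"
  shows "code w = carpet_map n m (w 0) (code (\<lambda>t. w (Suc t)))"
  unfolding code_def carpet_map_def
  using expansion_Suc[of n "\<lambda>t. fst (w t)", OF two_le_n fst_less[OF assms]]
    expansion_Suc[of m "\<lambda>t. snd (w t)", OF two_le_m snd_less[OF assms]] by (simp add: add.commute)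

lemma code_case_nat: "d \<in> D \<Longrightarrow> w \<in> Omega \<Longrightarrow> code (case_nat d w) = carpet_map n m d (code w)"
  using code_Suc[OF case_nat_Omega] by simp

lemma code_image_invariant: "code ` Omega = (\<Union>d\<in>D. carpet_map n m d ` code ` Omega)"
proof (intro equalityI subsetI)
  fix z assume "z \<in> code ` Omega"
  then obtain w where w: "w \<in> Omega" "z = code w" by blast
  moreover have "(\<lambda>t. w (Suc t)) \<in> Omega" using w by (simp add: Omega_def)
  ultimately show "z \<in> (\<Union>d\<in>D. carpet_map n m d ` code ` Omega)"
    using code_Suc[OF w(1)] OmegaD[OF w(1)] by blast
next
  fix z assume "z \<in> (\<Union>d\<in>D. carpet_map n m d ` code ` Omega)"
  then obtain d w where "d \<in> D" "w \<in> Omega" "z = carpet_map n m d (code w)" by blast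
  then show "z \<in> code ` Omega" using code_case_nat case_nat_Omega by (metis imageI)
qed

lemma continuous_expansion:
  assumes "2 \<le> b" and "\<And>w t. w \<in> A \<Longrightarrow> h (w t) < b" and h: "continuous_on UNIV h"
  shows "continuous_on A (\<lambda>w :: nat \<Rightarrow> nat \<times> nat. expansion b (\<lambda>t. h (w t)))"
proof -
  let ?g = "\<lambda>t (w :: nat \<Rightarrow> nat \<times> nat). real (h (w t)) / real b ^ Suc t"
  have g: "continuous_on A (?g t)" for t
  proof -
    have "continuous_on A (\<lambda>w. h (w t))"
      by (rule continuous_on_compose2[OF h continuous_on_subset[OF continuous_on_product_coordinates]]) auto
    then show ?thesis using assms(1) by (intro continuous_intros) auto
  qed
  have "uniform_limit A (\<lambda>k w. \<Sum>t<k. ?g t w) (\<lambda>w. \<Sum>t. ?g t w) sequentially"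
  proof (rule Weierstrass_m_test)
    fix t and w :: "nat \<Rightarrow> nat \<times> nat" assume "w \<in> A"
    then show "norm (?g t w) \<le> real (b - 1) / real b ^ Suc t"
      using expansion_term_le[of b "\<lambda>t. h (w t)" t, OF assms(1) assms(2)[of w t]] by simp
  qed (rule sums_summable[OF sums_top_digit[OF assms(1)]])
  then show ?thesis unfolding expansion_def
    by (rule uniform_limit_theorem[rotated])
      (rule trivial_limit_sequentially, intro always_eventually allI continuous_on_sum g)
qed

lemma compact_Omega: "compact Omega"
proof -
  have "compact D" by (rule finite_imp_compact) simp
  then have "compactin (product_topology (\<lambda>i. euclidean) UNIV) (PiE (UNIV :: nat set) (\<lambda>_. D))"
    unfolding compactin_PiE by auto
  moreover have "PiE (UNIV :: nat set) (\<lambda>_. D) = Omega"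
    by (auto simp: Omega_def PiE_iff)
  ultimately show ?thesis by (simp add: euclidean_product_topology)
qed

lemma compact_code_image: "compact (code ` Omega)"
proof (rule compact_continuous_image[OF _ compact_Omega])
  show "continuous_on Omega code" unfolding code_def
    by (intro continuous_on_Pair continuous_expansion two_le_n two_le_m fst_less snd_less continuous_intros)
qed

lemma dist_carpet_map: "dist (carpet_map n m d z) (carpet_map n m d z') \<le> dist z z' / real m"
proof -
  have 1: "dist ((fst z + real (fst d)) / real n) ((fst z' + real (fst d)) / real n)
      \<le> dist (fst z) (fst z') / real m"
  proof -
    have "dist ((fst z + real (fst d)) / real n) ((fst z' + real (fst d)) / real n)
      = dist (fst z) (fst z') / real n"
      by (simp add: dist_real_def flip: diff_divide_distrib)
    also have "\<dots> \<le> dist (fst z) (fst z') / real m"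
      using m_less_n two_le_m by (intro divide_left_mono) auto
    finally show ?thesis .
  qed
  have 2: "dist ((snd z + real (snd d)) / real m) ((snd z' + real (snd d)) / real m)
      = dist (snd z) (snd z') / real m"
    by (simp add: dist_real_def flip: diff_divide_distrib)
  have "dist (carpet_map n m d z) (carpet_map n m d z')
      \<le> sqrt ((dist (fst z) (fst z') / real m)\<^sup>2 + (dist (snd z) (snd z') / real m)\<^sup>2)"
    unfolding carpet_map_def dist_Pair_Pair 2
    by (intro real_sqrt_le_mono add_mono power_mono 1) auto
  also have "(dist (fst z) (fst z') / real m)\<^sup>2 + (dist (snd z) (snd z') / real m)\<^sup>2
      = ((dist (fst z) (fst z'))\<^sup>2 + (dist (snd z) (snd z'))\<^sup>2) / (real m)\<^sup>2"
    by (simp add: power_divide add_divide_distrib)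
  also have "sqrt \<dots> = dist z z' / real m"
    by (simp add: real_sqrt_divide dist_prod_def)
  finally show ?thesis .
qed

lemma tendsto_geometric_m: "(\<lambda>k. C / real m ^ k) \<longlonglongrightarrow> 0"
proof -
  have "(\<lambda>k. C * (1 / real m) ^ k) \<longlonglongrightarrow> C * 0"
    using two_le_m by (intro tendsto_mult tendsto_const LIMSEQ_power_zero) auto
  then show ?thesis by (simp add: power_divide)
qed

text \<open>Each use of the invariance applies one map to a pair of points and divides their
  distance by \<open>m\<close>, so \<open>E\<close> lies within \<open>C / m ^ k\<close> of
  \<open>F\<close> for every \<open>k\<close>. Both directions together give uniqueness of the
  attractor.\<close>

lemma invariant_set_subset:
  assumes "compact E" "compact F" "F \<noteq> {}"
    and E: "E = (\<Union>d\<in>D. carpet_map n m d ` E)" and F: "F = (\<Union>d\<in>D. carpet_map n m d ` F)"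
  shows "E \<subseteq> F"
proof
  have "bounded (E \<union> F)" using assms(1,2) by (simp add: compact_imp_bounded)
  then obtain C where C: "\<And>x y. x \<in> E \<Longrightarrow> y \<in> F \<Longrightarrow> dist x y \<le> C"
    unfolding bounded_two_points by blast
  have approx: "\<exists>y\<in>F. dist x y \<le> C / real m ^ k" if "x \<in> E" for x k
    using that
  proof (induction k arbitrary: x)
    case 0
    then show ?case using C \<open>F \<noteq> {}\<close> by auto
  next
    case (Suc k)
    from Suc.prems obtain d x' where d: "d \<in> D" "x' \<in> E" "x = carpet_map n m d x'"
      using E by blast
    with Suc.IH obtain y where y: "y \<in> F" "dist x' y \<le> C / real m ^ k" by blast
    have "carpet_map n m d y \<in> F" using F d(1) y(1) by blast
    moreover have "dist x (carpet_map n m d y) \<le> C / real m ^ Suc k"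
    proof -
      have "dist x (carpet_map n m d y) \<le> dist x' y / real m"
        unfolding d(3) by (rule dist_carpet_map)
      also have "\<dots> \<le> C / real m ^ k / real m" using y(2) by (intro divide_right_mono) auto
      finally show ?thesis by (simp add: mult.commute)
    qed
    ultimately show ?case by blast
  qed
  fix x assume x: "x \<in> E"
  have "\<exists>y\<in>F. dist y x < e" if "e > 0" for e
  proof -
    have "\<forall>\<^sub>F k in sequentially. C / real m ^ k < e"
      by (rule order_tendstoD(2)[OF tendsto_geometric_m that])
    then obtain k where k: "C / real m ^ k < e" by (auto simp: eventually_sequentially)
    from approx[OF x, of k] obtain y where "y \<in> F" "dist x y \<le> C / real m ^ k" by blast
    with k show ?thesis by (intro bexI[of _ y]) (auto simp: dist_commute)
  qed
  then show "x \<in> F"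
    using closure_approachable[of x F] assms(2) by (simp add: compact_imp_closed)
qed

lemma carpet_eq: "carpet n m D = code ` Omega"
  unfolding carpet_def
proof (rule the_equality)
  show "code ` Omega \<noteq> {} \<and> compact (code ` Omega)
      \<and> code ` Omega = (\<Union>d\<in>D. carpet_map n m d ` code ` Omega)"
    using compact_code_image code_image_invariant Omega_nonempty by blast
  fix E assume E: "E \<noteq> {} \<and> compact E \<and> E = (\<Union>d\<in>D. carpet_map n m d ` E)"
  then have E': "E \<noteq> {}" "compact E" "E = (\<Union>d\<in>D. carpet_map n m d ` E)" by blast+
  have ne: "code ` Omega \<noteq> {}" using Omega_nonempty by blast
  show "E = code ` Omega"
    using invariant_set_subset[OF E'(2) compact_code_image ne E'(3) code_image_invariant]
      invariant_set_subset[OF compact_code_image E'(2,1) code_image_invariant E'(3)]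
    by (rule equalityI)
qed

section \<open>Uniqueness of the self-similar measure\<close>

abbreviation nbhd :: "real \<Rightarrow> (real \<times> real) set \<Rightarrow> (real \<times> real) set" where
  "nbhd e A \<equiv> (\<Union>a\<in>A. ball a e)"

lemma continuous_carpet_map: "continuous_on UNIV (carpet_map n m d)"
  unfolding carpet_map_def using two_le_m two_le_n by (intro continuous_intros) auto

lemma carpet_map_measurable [measurable]: "carpet_map n m d \<in> borel_measurable borel"
  by (rule borel_measurable_continuous_onI[OF continuous_carpet_map])

text \<open>Pulling back along the contractions scales neighbourhoods by \<open>1 / m\<close>, so iterating the
  invariance \<open>k\<close> times compares two invariant measures up to a neighbourhood of size \<open>C / m ^ k\<close>.\<close>

lemma invariant_measure_le_nbhd:
  assumes M: "prob_space M" "sets M = sets borel"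
      "\<And>A. A \<in> sets borel \<Longrightarrow> measure M A = (1 / real (card D)) * (\<Sum>d\<in>D. measure M (carpet_map n m d -` A))"
    and M': "prob_space M'" "sets M' = sets borel"
      "\<And>A. A \<in> sets borel \<Longrightarrow> measure M' A = (1 / real (card D)) * (\<Sum>d\<in>D. measure M' (carpet_map n m d -` A))"
    and E: "E \<in> sets borel" "measure M E = 1" "measure M' E = 1"
    and C: "\<And>x y. x \<in> E \<Longrightarrow> y \<in> E \<Longrightarrow> dist x y < C"
    and A: "A \<in> sets borel"
  shows "measure M A \<le> measure M' (nbhd (C / real m ^ k) A)"
  using A
proof (induction k arbitrary: A)
  case 0
  interpret M: prob_space M by fact
  interpret M': prob_space M' by fact
  have sp: "space M = UNIV" "space M' = UNIV"
    using sets_eq_imp_space_eq[OF M(2)] sets_eq_imp_space_eq[OF M'(2)] by auto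
  show ?case
  proof (cases "A \<inter> E = {}")
    case True
    then have "measure M A \<le> measure M (UNIV - E)"
      using E(1) M(2) by (intro M.finite_measure_mono) auto
    also have "\<dots> = 0" using M.prob_compl[of E] E M(2) sp by simp
    finally have "measure M A \<le> 0" .
    then show ?thesis by (rule order_trans) simp
  next
    case False
    then obtain a where "a \<in> A" "a \<in> E" by blast
    \<comment> \<open>\<open>C\<close> exceeds every distance within \<open>E\<close>, so a single
      point of \<open>A\<close> in \<open>E\<close> is enough to cover \<open>E\<close>.\<close>
    then have "E \<subseteq> nbhd C A" by (intro subsetI UN_I[of a]) (auto intro: C)
    moreover have "open (nbhd C A)" by blast
    ultimately have "measure M' E \<le> measure M' (nbhd C A)"
      using M'(2) by (intro M'.finite_measure_mono) auto
    then show ?thesis unfolding power_0 div_by_1 using E(3) M.prob_le_1[of A] by linarith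
  qed
next
  case (Suc k)
  interpret M': prob_space M' by fact
  have "measure M A = (1 / real (card D)) * (\<Sum>d\<in>D. measure M (carpet_map n m d -` A))"
    by (fact M(3)[OF Suc.prems])
  also have "\<dots> \<le> (1 / real (card D)) * (\<Sum>d\<in>D. measure M' (carpet_map n m d -` nbhd (C / real m ^ Suc k) A))"
  proof (intro mult_left_mono sum_mono)
    fix d assume "d \<in> D"
    have meas: "carpet_map n m d -` X \<in> sets borel" if "X \<in> sets borel" for X
      using measurable_sets[OF carpet_map_measurable[of d] that] by simp
    have "measure M (carpet_map n m d -` A) \<le> measure M' (nbhd (C / real m ^ k) (carpet_map n m d -` A))"
      by (rule Suc.IH[OF meas[OF Suc.prems]])
    also have "\<dots> \<le> measure M' (carpet_map n m d -` nbhd (C / real m ^ Suc k) A)"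
    proof (rule M'.finite_measure_mono)
      have "open (nbhd (C / real m ^ Suc k) A)" by blast
      then show "carpet_map n m d -` nbhd (C / real m ^ Suc k) A \<in> M'.events"
        using meas M'(2) by auto
      show "nbhd (C / real m ^ k) (carpet_map n m d -` A) \<subseteq> carpet_map n m d -` nbhd (C / real m ^ Suc k) A"
      proof
        fix x assume "x \<in> nbhd (C / real m ^ k) (carpet_map n m d -` A)"
        then obtain a where a: "carpet_map n m d a \<in> A" "dist a x < C / real m ^ k"
          by (elim UN_E) (simp only: vimage_eq mem_ball)
        have "dist (carpet_map n m d a) (carpet_map n m d x) \<le> dist a x / real m"
          by (rule dist_carpet_map)
        also have "\<dots> < C / real m ^ k / real m"
          using a(2) two_le_m by (intro divide_strict_right_mono) auto
        also have "\<dots> = C / real m ^ Suc k" by simp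
        finally show "x \<in> carpet_map n m d -` nbhd (C / real m ^ Suc k) A"
          unfolding vimage_eq by (intro UN_I[OF a(1)]) (simp only: mem_ball)
      qed
    qed
    finally show "measure M (carpet_map n m d -` A)
      \<le> measure M' (carpet_map n m d -` nbhd (C / real m ^ Suc k) A)" .
  qed simp
  also have "\<dots> = measure M' (nbhd (C / real m ^ Suc k) A)"
    by (rule M'(3)[of "nbhd (C / real m ^ Suc k) A", symmetric])
      (intro borel_open open_UN ballI open_ball)
  finally show ?case .
qed

text \<open>Neighbourhoods of a closed set decrease to the set, so the error in
  \<open>invariant_measure_le_nbhd\<close> disappears by continuity from above.\<close>

lemma invariant_measure_closed_le:
  assumes M: "prob_space M" "sets M = sets borel"
      "\<And>A. A \<in> sets borel \<Longrightarrow> measure M A = (1 / real (card D)) * (\<Sum>d\<in>D. measure M (carpet_map n m d -` A))"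
    and M': "prob_space M'" "sets M' = sets borel"
      "\<And>A. A \<in> sets borel \<Longrightarrow> measure M' A = (1 / real (card D)) * (\<Sum>d\<in>D. measure M' (carpet_map n m d -` A))"
    and E: "compact E" "measure M E = 1" "measure M' E = 1"
    and A: "closed A"
  shows "measure M A \<le> measure M' A"
proof -
  interpret M': prob_space M' by fact
  obtain C where "\<And>x y. x \<in> E \<Longrightarrow> y \<in> E \<Longrightarrow> dist x y \<le> C"
    using compact_imp_bounded[OF E(1)] unfolding bounded_two_points by blast
  \<comment> \<open>The diameter may be zero, but open balls need a positive radius and a strict
    bound.\<close>
  then have C: "\<And>x y. x \<in> E \<Longrightarrow> y \<in> E \<Longrightarrow> dist x y < \<bar>C\<bar> + 1" by (smt (verit))
  define S where "S k = nbhd ((\<bar>C\<bar> + 1) / real m ^ k) A" for k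
  have "(\<lambda>k. measure M' (S k)) \<longlonglongrightarrow> measure M' (\<Inter>k. S k)"
  proof (rule M'.finite_Lim_measure_decseq)
    show "range S \<subseteq> M'.events" by (auto simp: M'(2) S_def open_UN)
    show "decseq S"
    proof (rule decseq_SucI)
      fix k
      have "(\<bar>C\<bar> + 1) / real m ^ Suc k \<le> (\<bar>C\<bar> + 1) / real m ^ k"
        using two_le_m by (intro divide_left_mono power_increasing) auto
      then show "S (Suc k) \<le> S k" unfolding S_def by (intro UN_mono subset_ball) auto
    qed
  qed
  moreover have "(\<Inter>k. S k) = A"
  proof
    show "A \<subseteq> (\<Inter>k. S k)"
    proof
      fix a assume "a \<in> A"
      moreover have "0 < (\<bar>C\<bar> + 1) / real m ^ k" for k using two_le_m by simp
      ultimately show "a \<in> (\<Inter>k. S k)" unfolding S_def by (meson INT_I UN_I centre_in_ball)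
    qed
    show "(\<Inter>k. S k) \<subseteq> A"
    proof
      fix x assume x: "x \<in> (\<Inter>k. S k)"
      have "\<exists>a\<in>A. dist a x < e" if "e > 0" for e
      proof -
        have "\<forall>\<^sub>F k in sequentially. (\<bar>C\<bar> + 1) / real m ^ k < e"
          by (rule order_tendstoD(2)[OF tendsto_geometric_m that])
        then obtain k where k: "(\<bar>C\<bar> + 1) / real m ^ k < e" by (auto simp: eventually_sequentially)
        from x have "x \<in> S k" by blast
        then show ?thesis using k unfolding S_def by force
      qed
      then show "x \<in> A" using closure_approachable[of x A] A by simp
    qed
  qed
  ultimately have "(\<lambda>k. measure M' (S k)) \<longlonglongrightarrow> measure M' A" by simp
  moreover have "measure M A \<le> measure M' (S k)" for k unfolding S_def
    by (rule invariant_measure_le_nbhd[OF M M' _ E(2,3) C])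
      (use A E(1) in \<open>auto simp: compact_imp_closed\<close>)
  ultimately show ?thesis by (intro LIMSEQ_le_const) auto
qed

lemma invariant_measure_unique:
  assumes M: "prob_space M" "sets M = sets borel"
      "\<And>A. A \<in> sets borel \<Longrightarrow> measure M A = (1 / real (card D)) * (\<Sum>d\<in>D. measure M (carpet_map n m d -` A))"
    and M': "prob_space M'" "sets M' = sets borel"
      "\<And>A. A \<in> sets borel \<Longrightarrow> measure M' A = (1 / real (card D)) * (\<Sum>d\<in>D. measure M' (carpet_map n m d -` A))"
    and E: "compact E" "measure M E = 1" "measure M' E = 1"
  shows "M = M'"
proof -
  interpret M: prob_space M by fact
  interpret M': prob_space M' by fact
  have borel: "sets (borel :: (real \<times> real) measure) = sigma_sets UNIV {A. closed A}"
    by (subst borel_eq_closed) (rule sets_measure_of, simp)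
  have eq: "emeasure M X = emeasure M' X" if "X \<in> {A. closed A}" for X
  proof -
    have "closed X" using that by simp
    then have "measure M X = measure M' X"
      by (intro antisym invariant_measure_closed_le[OF M M' E] invariant_measure_closed_le[OF M' M E(1,3,2)])
    then show ?thesis by (simp only: M.emeasure_eq_measure M'.emeasure_eq_measure)
  qed
  show ?thesis
    by (rule measure_eqI_generator_eq[OF _ _ eq trans[OF M(2) borel] trans[OF M'(2) borel],
          where A = "\<lambda>_. UNIV"])
      (auto simp only: Int_stable_def M.emeasure_finite closed_Int Pow_UNIV closed_UNIV
         mem_Collect_eq image_subset_iff UN_constant if_False UNIV_not_empty subset_UNIV infinity_ennreal_def)
qed

end

text \<open>The complement of the support is a union of null balls, and the Lindelof property
  reduces it to a countable union. This is needed because \<open>carpet_measure\<close> constrains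
  the support and not the mass of the carpet.\<close>

lemma measure_support_subset_imp_full:
  fixes M :: "'a :: {metric_space, second_countable_topology} measure"
  assumes "prob_space M" "sets M = sets borel" "closed E" "measure_support M \<subseteq> E"
  shows "measure M E = 1"
proof -
  interpret prob_space M by fact
  define F where "F = {ball x r | x r. emeasure M (ball x r) = 0}"
  obtain F' where F': "F' \<subseteq> F" "countable F'" "\<Union>F' = \<Union>F"
    using Lindelof[of F] unfolding F_def by blast
  have "(\<Union>X\<in>F'. X) \<in> null_sets M"
  proof (rule null_sets_UN')
    fix X assume "X \<in> F'"
    then obtain x r where "X = ball x r" "emeasure M (ball x r) = 0" using F'(1) unfolding F_def by blast
    then show "X \<in> null_sets M" using assms(2) by (simp add: null_sets_def)
  qed fact
  moreover have "space M - E \<subseteq> \<Union>F"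
  proof
    fix x assume "x \<in> space M - E"
    then have "x \<notin> measure_support M" using assms(4) by blast
    then obtain r where "r > 0" "emeasure M (ball x r) = 0"
      unfolding measure_support_def by auto
    then show "x \<in> \<Union>F" unfolding F_def by (intro UnionI[of "ball x r"]) auto
  qed
  moreover have E: "E \<in> sets M" using assms(2,3) by simp
  ultimately have "space M - E \<in> null_sets M"
    using F'(3) by (intro null_sets_subset[of "\<Union>X\<in>F'. X" M "space M - E"]) (simp_all only: image_ident sets.compl_sets)
  then have "prob (space M - E) = 0" by (simp add: measure_def null_setsD1)
  then show ?thesis using prob_compl[OF E] by simp
qed

section \<open>The Bernoulli measure and its image in the plane\<close>

context bedford_mcmullen
begin

sublocale B: sequence_space "uniform_count_measure D"
  by (rule sequence_space.intro, rule product_prob_spaceI,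
      rule prob_space_uniform_count_measure[OF finite_D D_nonempty])

abbreviation bernoulli :: "(nat \<Rightarrow> nat \<times> nat) measure" where
  "bernoulli \<equiv> PiM UNIV (\<lambda>_. uniform_count_measure D)"

lemma space_bernoulli [simp]: "space bernoulli = Omega"
  by (auto simp: space_PiM space_uniform_count_measure Omega_def PiE_iff)

lemma digit_measurable [measurable]: "(\<lambda>w. h (w t)) \<in> measurable bernoulli (count_space UNIV)"
proof (rule measurable_compose[of "\<lambda>w. w t" _ "uniform_count_measure D" h])
  show "(\<lambda>w. w t) \<in> measurable bernoulli (uniform_count_measure D)" by simp
  show "h \<in> measurable (uniform_count_measure D) (count_space UNIV)"
    by (auto simp: measurable_def space_uniform_count_measure sets_uniform_count_measure)
qed

lemma expansion_measurable [measurable]: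
  "(\<lambda>w. expansion b (\<lambda>t. h (w t))) \<in> borel_measurable bernoulli"
proof -
  have "(\<lambda>w. real (h (w t))) \<in> borel_measurable bernoulli" for t
    by (rule measurable_compose[OF digit_measurable]) simp
  then show ?thesis unfolding expansion_def by measurable
qed

lemma code_measurable [measurable]: "code \<in> borel_measurable bernoulli"
  unfolding code_def by measurable

lemma word_value_measurable [measurable]:
  "(\<lambda>w. word_value b (\<lambda>t. h (w t)) k) \<in> measurable bernoulli (count_space UNIV)"
proof (induction k)
  case (Suc k)
  have "(\<lambda>w. b * i + h (w k)) \<in> measurable bernoulli (count_space UNIV)" for i
    by (rule digit_measurable)
  from measurable_compose_countable[of "\<lambda>i w. b * i + h (w k)", OF this Suc]
  show ?case unfolding word_value.simps .
qed simp

lemma code_preimage_measurable [measurable]: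
  assumes "A \<in> sets borel"
  shows "{w \<in> Omega. code w \<in> A} \<in> sets bernoulli"
proof -
  have "{w \<in> Omega. code w \<in> A} = code -` A \<inter> space bernoulli" unfolding space_bernoulli by blast
  then show ?thesis using measurable_sets[OF code_measurable assms] by (simp only:)
qed

lemma prob_cylinder:
  assumes "finite J" "\<And>t. t \<in> J \<Longrightarrow> X t \<subseteq> D"
  shows "measure bernoulli {w \<in> Omega. \<forall>t\<in>J. w t \<in> X t} = (\<Prod>t\<in>J. real (card (X t)) / real (card D))"
proof -
  have "emeasure bernoulli {w \<in> Omega. \<forall>t\<in>J. w t \<in> X t}
      = (\<Prod>t\<in>J. emeasure (uniform_count_measure D) (X t))"
    using B.emeasure_PiM_Collect[of J X] assms by (simp add: sets_uniform_count_measure)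
  also have "\<dots> = (\<Prod>t\<in>J. ennreal (real (card (X t)) / real (card D)))"
    using assms by (intro prod.cong) (auto simp: emeasure_uniform_count_measure)
  also have "\<dots> = ennreal (\<Prod>t\<in>J. real (card (X t)) / real (card D))"
    by (intro prod_ennreal) simp
  finally show ?thesis by (simp add: measure_def prod_nonneg)
qed

definition mu :: "(real \<times> real) measure" where
  "mu = distr bernoulli borel code"

lemma prob_space_mu: "prob_space mu"
  unfolding mu_def by (rule B.prob_space_distr) measurable

lemma sets_mu: "sets mu = sets borel"
  by (simp add: mu_def)

lemma measure_mu: "A \<in> sets borel \<Longrightarrow> measure mu A = measure bernoulli {w \<in> Omega. code w \<in> A}"
  unfolding mu_def by (subst measure_distr) (auto simp: vimage_def Int_def conj_commute)

text \<open>Prepending an independent uniform digit preserves the Bernoulli measure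
  (\<open>B.PiM_iter\<close>), and integrating over that digit gives the sum. Under
  \<open>code\<close>, prepending \<open>d\<close> becomes \<open>carpet_map n m d\<close>, which
  makes \<open>mu\<close> invariant.\<close>

lemma emeasure_case_nat:
  assumes A: "A \<in> sets bernoulli"
  shows "emeasure bernoulli A = (\<Sum>d\<in>D. ennreal (1 / real (card D)) * emeasure bernoulli {w \<in> Omega. case_nat d w \<in> A})"
proof -
  let ?U = "uniform_count_measure D"
  have meas: "(\<lambda>(s, w). case_nat s w) \<in> measurable (?U \<Otimes>\<^sub>M bernoulli) bernoulli"
    by measurable
  have "emeasure bernoulli A = emeasure (distr (?U \<Otimes>\<^sub>M bernoulli) bernoulli (\<lambda>(s, w). case_nat s w)) A"
    by (simp only: B.PiM_iter)
  also have "\<dots> = emeasure (?U \<Otimes>\<^sub>M bernoulli) ((\<lambda>(s, w). case_nat s w) -` A \<inter> space (?U \<Otimes>\<^sub>M bernoulli))"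
    by (rule emeasure_distr[OF meas A])
  also have "\<dots> = (\<integral>\<^sup>+ d. emeasure bernoulli (Pair d -` ((\<lambda>(s, w). case_nat s w) -` A \<inter> space (?U \<Otimes>\<^sub>M bernoulli))) \<partial>?U)"
    by (rule B.P.emeasure_pair_measure_alt[OF measurable_sets[OF meas A]])
  also have "\<dots> = (\<Sum>d\<in>D. ennreal (1 / real (card D)) * emeasure bernoulli (Pair d -` ((\<lambda>(s, w). case_nat s w) -` A \<inter> space (?U \<Otimes>\<^sub>M bernoulli))))"
    unfolding uniform_count_measure_def
    by (rule nn_integral_point_measure_finite) simp
  also have "\<dots> = (\<Sum>d\<in>D. ennreal (1 / real (card D)) * emeasure bernoulli {w \<in> Omega. case_nat d w \<in> A})"
  proof (intro sum.cong refl arg_cong2[where f = "(*)"] arg_cong2[where f = emeasure])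
    fix d assume "d \<in> D"
    then show "Pair d -` ((\<lambda>(s, w). case_nat s w) -` A \<inter> space (?U \<Otimes>\<^sub>M bernoulli)) = {w \<in> Omega. case_nat d w \<in> A}"
      by (auto simp: space_pair_measure space_uniform_count_measure simp del: space_PiM)
  qed
  finally show ?thesis .
qed

lemma mu_invariant:
  assumes A: "A \<in> sets borel"
  shows "measure mu A = (1 / real (card D)) * (\<Sum>d\<in>D. measure mu (carpet_map n m d -` A))"
proof -
  have 1: "measure mu (carpet_map n m d -` A) = measure bernoulli {w \<in> Omega. case_nat d w \<in> {w \<in> Omega. code w \<in> A}}"
    if "d \<in> D" for d
  proof -
    have "carpet_map n m d -` A \<in> sets borel"
      using measurable_sets[OF carpet_map_measurable[of d] A] by simp
    then have "measure mu (carpet_map n m d -` A) = measure bernoulli {w \<in> Omega. code w \<in> carpet_map n m d -` A}"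
      by (rule measure_mu)
    also have "{w \<in> Omega. code w \<in> carpet_map n m d -` A} = {w \<in> Omega. case_nat d w \<in> {w \<in> Omega. code w \<in> A}}"
      using code_case_nat[OF that] case_nat_Omega[OF that] by auto
    finally show ?thesis .
  qed
  have "ennreal (measure mu A) = (\<Sum>d\<in>D. ennreal (1 / real (card D)) * emeasure bernoulli {w \<in> Omega. case_nat d w \<in> {w \<in> Omega. code w \<in> A}})"
    unfolding measure_mu[OF A] B.P.emeasure_eq_measure[symmetric]
    by (rule emeasure_case_nat[OF code_preimage_measurable[OF A]])
  also have "\<dots> = (\<Sum>d\<in>D. ennreal (1 / real (card D) * measure mu (carpet_map n m d -` A)))"
    by (intro sum.cong refl) (simp only: 1 B.P.emeasure_eq_measure ennreal_mult[OF _ measure_nonneg] divide_nonneg_nonneg zero_le_one of_nat_0_le_iff)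
  also have "\<dots> = ennreal (\<Sum>d\<in>D. 1 / real (card D) * measure mu (carpet_map n m d -` A))"
    by (intro sum_ennreal) simp
  finally show ?thesis
    by (subst (asm) ennreal_inj)
      (simp_all only: sum_distrib_left sum_nonneg measure_nonneg mult_nonneg_nonneg divide_nonneg_nonneg
        zero_le_one of_nat_0_le_iff)
qed

lemma closed_code_image: "closed (code ` Omega)"
  by (rule compact_imp_closed[OF compact_code_image])

lemma measure_support_mu: "measure_support mu \<subseteq> code ` Omega"
proof
  fix z assume z: "z \<in> measure_support mu"
  show "z \<in> code ` Omega"
  proof (rule ccontr)
    assume "z \<notin> code ` Omega"
    then have "z \<in> - code ` Omega" by blast
    from openE[OF open_Compl[OF closed_code_image] this]
    obtain e where e: "e > 0" "ball z e \<subseteq> - code ` Omega" by blast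
    then have "{w \<in> Omega. code w \<in> ball z e} = {}" by blast
    then have "measure mu (ball z e) = 0" using measure_mu[of "ball z e"] by (simp only: measure_empty borel_open open_ball)
    then have "emeasure mu (ball z e) = 0"
      using finite_measure.emeasure_eq_measure[OF prob_space.finite_measure[OF prob_space_mu]] by simp
    moreover have "emeasure mu (ball z e) > 0" using z e(1) unfolding measure_support_def by blast
    ultimately show False by simp
  qed
qed

lemma carpet_measure_eq: "carpet_measure n m D = mu"
  unfolding carpet_measure_def
proof (rule the_equality)
  show "prob_space mu \<and> sets mu = sets borel \<and> measure_support mu \<subseteq> carpet n m D \<and>
      (\<forall>A\<in>sets borel. measure mu A = (1 / real (card D)) * (\<Sum>d\<in>D. measure mu (carpet_map n m d -` A)))"
    using prob_space_mu sets_mu measure_support_mu mu_invariant carpet_eq by metis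
  fix M assume "prob_space M \<and> sets M = sets borel \<and> measure_support M \<subseteq> carpet n m D \<and>
      (\<forall>A\<in>sets borel. measure M A = (1 / real (card D)) * (\<Sum>d\<in>D. measure M (carpet_map n m d -` A)))"
  then have M: "prob_space M" "sets M = sets borel" "measure_support M \<subseteq> code ` Omega"
    "\<And>A. A \<in> sets borel \<Longrightarrow> measure M A = (1 / real (card D)) * (\<Sum>d\<in>D. measure M (carpet_map n m d -` A))"
    unfolding carpet_eq by blast+
  show "M = mu"
    by (rule invariant_measure_unique[OF M(1,2,4) prob_space_mu sets_mu mu_invariant compact_code_image
        measure_support_subset_imp_full[OF M(1,2) closed_code_image M(3)]
        measure_support_subset_imp_full[OF prob_space_mu sets_mu closed_code_image measure_support_mu]])
qed

text \<open>Translates masses of balls in the carpet into probabilities of events about digit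
  sequences.\<close>

lemma measure_carpet_Int:
  assumes "A \<in> sets borel"
  shows "measure (carpet_measure n m D) (carpet n m D \<inter> A) = measure bernoulli {w \<in> Omega. code w \<in> A}"
proof -
  have "carpet n m D \<inter> A \<in> sets borel"
    unfolding carpet_eq using closed_code_image assms by auto
  then have "measure mu (carpet n m D \<inter> A) = measure bernoulli {w \<in> Omega. code w \<in> carpet n m D \<inter> A}"
    by (rule measure_mu)
  also have "{w \<in> Omega. code w \<in> carpet n m D \<inter> A} = {w \<in> Omega. code w \<in> A}"
    unfolding carpet_eq by blast
  finally show ?thesis by (simp only: carpet_measure_eq)
qed

section \<open>Approximate squares\<close>

text \<open>An integer index instead of a word: neighbouring rows then differ by one, and
  \<open>word_value_Suc_eqD\<close> relates their digits.\<close>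

definition row :: "(nat \<Rightarrow> nat \<times> nat) \<Rightarrow> nat \<Rightarrow> nat" where
  "row w k = word_value m (\<lambda>t. snd (w t)) k"

definition column :: "(nat \<Rightarrow> nat \<times> nat) \<Rightarrow> nat \<Rightarrow> nat" where
  "column w l = word_value n (\<lambda>t. fst (w t)) l"

text \<open>For \<open>l \<le> k\<close> this is the mass of the approximate square of \<open>w\<close>, see \<open>prob_square\<close>.\<close>

definition weight :: "(nat \<Rightarrow> nat \<times> nat) \<Rightarrow> nat \<Rightarrow> nat \<Rightarrow> real" where
  "weight w k l = (\<Prod>t\<in>{l..<k}. real (fiber D (snd (w t)))) / real (card D) ^ k"

lemma row_measurable [measurable]: "(\<lambda>w. row w k) \<in> measurable bernoulli (count_space UNIV)"
  unfolding row_def by measurable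

lemma column_measurable [measurable]: "(\<lambda>w. column w l) \<in> measurable bernoulli (count_space UNIV)"
  unfolding column_def by measurable

lemma row_eq_iff:
  assumes "w \<in> Omega" "v \<in> Omega"
  shows "row w k = row v k \<longleftrightarrow> (\<forall>t<k. snd (w t) = snd (v t))"
proof
  assume "row w k = row v k"
  then show "\<forall>t<k. snd (w t) = snd (v t)"
    unfolding row_def
    using word_value_eqD[of m "\<lambda>t. snd (w t)" k "\<lambda>t. snd (v t)", OF _ snd_less[OF assms(1)] snd_less[OF assms(2)]]
    by simp
next
  assume "\<forall>t<k. snd (w t) = snd (v t)"
  then show "row w k = row v k" unfolding row_def by (intro word_value_cong) simp
qed

lemma column_eq_iff:
  assumes "w \<in> Omega" "v \<in> Omega"
  shows "column w l = column v l \<longleftrightarrow> (\<forall>t<l. fst (w t) = fst (v t))"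
proof
  assume "column w l = column v l"
  then show "\<forall>t<l. fst (w t) = fst (v t)"
    unfolding column_def
    using word_value_eqD[of n "\<lambda>t. fst (w t)" l "\<lambda>t. fst (v t)", OF _ fst_less[OF assms(1)] fst_less[OF assms(2)]]
    by simp
next
  assume "\<forall>t<l. fst (w t) = fst (v t)"
  then show "column w l = column v l" unfolding column_def by (intro word_value_cong) simp
qed

lemma card_row: "card {d \<in> D. snd d = j} = fiber D j"
proof -
  have "{d \<in> D. snd d = j} = (\<lambda>i. (i, j)) ` {i. (i, j) \<in> D}" by force
  then show ?thesis unfolding fiber_def by (simp add: card_image inj_on_def)
qed

lemma fiber_pos: "(i, j) \<in> D \<Longrightarrow> 0 < fiber D j"
  unfolding card_row[symmetric] by (subst card_gt_0_iff) auto

lemma fiber_posD: "0 < fiber D j \<Longrightarrow> \<exists>i. (i, j) \<in> D"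
  unfolding fiber_def by (metis Collect_empty_eq card.empty less_irrefl)

lemma fiber_digit_ge_1:
  assumes "w \<in> Omega"
  shows "1 \<le> fiber D (snd (w t))"
proof -
  have "(fst (w t), snd (w t)) \<in> D" using OmegaD[OF assms, of t] by simp
  from fiber_pos[OF this] show ?thesis by linarith
qed

lemma fiber_le: "fiber D j \<le> n"
proof -
  have "{i. (i, j) \<in> D} \<subseteq> {0..<n}" using D_subset by auto
  then have "card {i. (i, j) \<in> D} \<le> card {0..<n}" by (intro card_mono) auto
  then show ?thesis by (simp add: fiber_def)
qed

lemma weight_pos:
  assumes "w \<in> Omega" shows "0 < weight w k l"
  unfolding weight_def
proof (intro divide_pos_pos prod_pos ballI zero_less_power)
  show "0 < real (card D)" using card_D_pos by linarith
  show "0 < real (fiber D (snd (w t)))" for t using fiber_digit_ge_1[OF assms, of t] by linarith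
qed

text \<open>The first \<open>l\<close> digits are prescribed in both coordinates, which leaves one
  choice; those from \<open>l\<close> to \<open>k - 1\<close> are prescribed in the row only, which
  leaves a fiber.\<close>

lemma prob_square:
  assumes "w \<in> Omega" "l \<le> k"
  shows "measure bernoulli {v \<in> Omega. row v k = row w k \<and> column v l = column w l} = weight w k l"
proof -
  define X where "X t = (if t < l then {w t} else {d \<in> D. snd d = snd (w t)})" for t
  have "{v \<in> Omega. row v k = row w k \<and> column v l = column w l} = {v \<in> Omega. \<forall>t\<in>{..<k}. v t \<in> X t}"
  proof (intro Collect_cong conj_cong refl)
    fix v assume v: "v \<in> Omega"
    show "row v k = row w k \<and> column v l = column w l \<longleftrightarrow> (\<forall>t\<in>{..<k}. v t \<in> X t)"
      unfolding row_eq_iff[OF v assms(1)] column_eq_iff[OF v assms(1)]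
      using assms(2) OmegaD[OF v] by (auto simp: X_def prod_eq_iff)
  qed
  also have "measure bernoulli \<dots> = (\<Prod>t\<in>{..<k}. real (card (X t)) / real (card D))"
    by (rule prob_cylinder) (use OmegaD[OF assms(1)] in \<open>auto simp: X_def\<close>)
  also have "\<dots> = (\<Prod>t\<in>{..<k}. real (card (X t))) / real (card D) ^ k"
    by (simp add: prod_dividef)
  also have "(\<Prod>t\<in>{..<k}. real (card (X t))) = (\<Prod>t\<in>{l..<k}. real (fiber D (snd (w t))))"
    by (rule prod.mono_neutral_cong_right) (auto simp: X_def card_row)
  finally show ?thesis by (simp add: weight_def)
qed

text \<open>Moving one level deeper drops a fiber of at most \<open>n\<close> digits, adds a
  nonempty one and puts one more factor \<open>card D\<close> into the denominator. Hence the
  passage from radius \<open>r\<close> to \<open>\<rho> * r\<close> costs only a constant.\<close>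

lemma weight_Suc_ge:
  assumes "w \<in> Omega" "l \<le> k"
  shows "weight w k l \<le> real (card D * n) * weight w (Suc k) (Suc l)"
proof -
  let ?a = "\<lambda>t. real (fiber D (snd (w t)))"
  have "(\<Prod>t\<in>{l..<k}. ?a t) \<le> real n * (\<Prod>t\<in>{Suc l..<Suc k}. ?a t)"
  proof (cases "l = k")
    case True
    then show ?thesis using two_le_n by simp
  next
    case False
    then have lk: "l < k" using assms(2) by simp
    have pos: "0 \<le> (\<Prod>t\<in>{Suc l..<k}. ?a t)" by (intro prod_nonneg) simp
    have "(\<Prod>t\<in>{l..<k}. ?a t) = ?a l * (\<Prod>t\<in>{Suc l..<k}. ?a t)"
      using lk by (rule prod.atLeast_Suc_lessThan)
    also have "\<dots> \<le> real n * (\<Prod>t\<in>{Suc l..<k}. ?a t)"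
      using fiber_le pos by (intro mult_right_mono) auto
    also have "\<dots> \<le> real n * ((\<Prod>t\<in>{Suc l..<k}. ?a t) * ?a k)"
      using fiber_digit_ge_1[OF assms(1), of k] pos by (intro mult_left_mono mult_right_le_one_le[THEN order_trans] mult_le_cancel_left1[THEN iffD2]) auto
    also have "(\<Prod>t\<in>{Suc l..<k}. ?a t) * ?a k = (\<Prod>t\<in>{Suc l..<Suc k}. ?a t)"
      using lk by simp
    finally show ?thesis .
  qed
  then have "(\<Prod>t\<in>{l..<k}. ?a t) / real (card D) ^ k \<le> real n * (\<Prod>t\<in>{Suc l..<Suc k}. ?a t) / real (card D) ^ k"
    by (intro divide_right_mono) auto
  moreover have "real n * P / real (card D) ^ k = real (card D * n) * (P / real (card D) ^ Suc k)" for P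
  proof -
    have "real (card D) \<noteq> 0" using card_D_pos by linarith
    then show ?thesis by (simp del: of_nat_eq_0_iff)
  qed
  ultimately show ?thesis unfolding weight_def by (simp only:)
qed

lemma weight_add_ge:
  assumes "w \<in> Omega" "l \<le> k"
  shows "weight w k l \<le> real (card D * n) ^ c * weight w (k + c) (l + c)"
proof (induction c)
  case (Suc c)
  have "real (card D * n) ^ c * weight w (k + c) (l + c)
      \<le> real (card D * n) ^ c * (real (card D * n) * weight w (Suc (k + c)) (Suc (l + c)))"
    using assms by (intro mult_left_mono weight_Suc_ge) auto
  with Suc show ?case by (simp add: mult.assoc mult.left_commute)
qed simp

lemma dist_code_le:
  "dist (code w) (code v) \<le> \<bar>expansion n (\<lambda>t. fst (w t)) - expansion n (\<lambda>t. fst (v t))\<bar>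
     + \<bar>expansion m (\<lambda>t. snd (w t)) - expansion m (\<lambda>t. snd (v t))\<bar>"
  unfolding code_def dist_Pair_Pair dist_real_def
  by (rule sqrt_sum_squares_le_sum_abs[THEN order_trans]) simp

lemma prob_ball_ge:
  assumes "w \<in> Omega" "l \<le> k" "1 / real m ^ k + 1 / real n ^ l < s"
  shows "weight w k l \<le> measure bernoulli {v \<in> Omega. code v \<in> ball (code w) s}"
proof -
  have "weight w k l = measure bernoulli {v \<in> Omega. row v k = row w k \<and> column v l = column w l}"
    using prob_square[OF assms(1,2)] by simp
  also have "\<dots> \<le> measure bernoulli {v \<in> Omega. code v \<in> ball (code w) s}"
  proof (rule B.P.finite_measure_mono)
    show "{v \<in> Omega. code v \<in> ball (code w) s} \<in> B.P.events" by (rule code_preimage_measurable) simp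
    show "{v \<in> Omega. row v k = row w k \<and> column v l = column w l} \<subseteq> {v \<in> Omega. code v \<in> ball (code w) s}"
    proof safe
      fix v assume v: "v \<in> Omega" "row v k = row w k" "column v l = column w l"
      have "\<bar>expansion n (\<lambda>t. fst (w t)) - expansion n (\<lambda>t. fst (v t))\<bar> \<le> 1 / real n ^ l"
        using column_eq_iff[OF v(1) assms(1)] v(3)
        by (intro expansion_dist_le two_le_n fst_less v(1) assms(1)) auto
      moreover have "\<bar>expansion m (\<lambda>t. snd (w t)) - expansion m (\<lambda>t. snd (v t))\<bar> \<le> 1 / real m ^ k"
        using row_eq_iff[OF v(1) assms(1)] v(2)
        by (intro expansion_dist_le two_le_m snd_less v(1) assms(1)) auto
      ultimately show "code v \<in> ball (code w) s" using assms(3) dist_code_le[of w v] by simp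
    qed
  qed
  finally show ?thesis .
qed

text \<open>Three column words and three row words give at most nine squares. \<open>I\<close> and
  \<open>J\<close> are integers so that \<open>I - 1\<close> and \<open>J - 1\<close> do not
  truncate at zero.\<close>

lemma prob_cover_le:
  assumes A: "A \<in> sets borel" and "l \<le> k" "0 \<le> b"
    and cov: "\<And>v. v \<in> Omega \<Longrightarrow> code v \<in> A \<Longrightarrow> \<bar>int (column v l) - I\<bar> \<le> 1 \<and> \<bar>int (row v k) - J\<bar> \<le> 1
      \<and> weight v k l \<le> b"
  shows "measure bernoulli {v \<in> Omega. code v \<in> A} \<le> 9 * b"
proof -
  let ?K = "{I - 1, I, I + 1} \<times> {J - 1, J, J + 1}"
  define T where "T p = {v \<in> Omega. int (column v l) = fst p \<and> int (row v k) = snd p} \<inter> {v \<in> Omega. code v \<in> A}" for p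
  have meas: "{v \<in> Omega. int (column v l) = x \<and> int (row v k) = y} \<in> sets bernoulli" for x y
  proof -
    have "{v \<in> space bernoulli. int (column v l) = x \<and> int (row v k) = y} \<in> sets bernoulli" by measurable
    then show ?thesis unfolding space_bernoulli .
  qed
  have T: "T p \<in> sets bernoulli" for p
    unfolding T_def by (intro sets.Int meas code_preimage_measurable A)
  have le: "measure bernoulli (T p) \<le> b" for p
  proof (cases "T p = {}")
    case True
    then show ?thesis using assms(3) by simp
  next
    case False
    then obtain v where v: "v \<in> T p" by blast
    then have v': "v \<in> Omega" "code v \<in> A" unfolding T_def by auto
    have "measure bernoulli (T p) \<le> measure bernoulli {u \<in> Omega. row u k = row v k \<and> column u l = column v l}"
    proof (rule B.P.finite_measure_mono)
      show "T p \<subseteq> {u \<in> Omega. row u k = row v k \<and> column u l = column v l}"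
        using v unfolding T_def by auto
      show "{u \<in> Omega. row u k = row v k \<and> column u l = column v l} \<in> B.P.events"
        using meas[of "int (column v l)" "int (row v k)"] by (simp only: conj_commute of_nat_eq_iff)
    qed
    also have "\<dots> = weight v k l" by (rule prob_square[OF v'(1) assms(2)])
    also have "\<dots> \<le> b" using cov[OF v'] by blast
    finally show ?thesis .
  qed
  have "{v \<in> Omega. code v \<in> A} \<subseteq> (\<Union>p\<in>?K. T p)"
  proof
    fix v assume v: "v \<in> {v \<in> Omega. code v \<in> A}"
    then have "\<bar>int (column v l) - I\<bar> \<le> 1" "\<bar>int (row v k) - J\<bar> \<le> 1" using cov[of v] by auto
    then have "int (column v l) = I - 1 \<or> int (column v l) = I \<or> int (column v l) = I + 1"
      "int (row v k) = J - 1 \<or> int (row v k) = J \<or> int (row v k) = J + 1" by linarith+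
    then have "(int (column v l), int (row v k)) \<in> ?K" by blast
    moreover have "v \<in> T (int (column v l), int (row v k))" using v unfolding T_def by simp
    ultimately show "v \<in> (\<Union>p\<in>?K. T p)" by blast
  qed
  then have "measure bernoulli {v \<in> Omega. code v \<in> A} \<le> measure bernoulli (\<Union>p\<in>?K. T p)"
    using T by (intro B.P.finite_measure_mono) auto
  also have "\<dots> \<le> (\<Sum>p\<in>?K. measure bernoulli (T p))"
    using T by (intro B.P.finite_measure_subadditive_finite) auto
  also have "\<dots> \<le> (\<Sum>p\<in>?K. b)" by (intro sum_mono le)
  also have "\<dots> = 9 * b" by (simp add: card_cartesian_product)
  finally show ?thesis .
qed

end

lemma ex_power_scale:
  fixes r :: real
  assumes "2 \<le> b" "0 < r" "r \<le> 1"
  obtains k where "1 / real b ^ Suc k < r" "r \<le> 1 / real b ^ k"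
proof -
  have "\<exists>k. (1 / real b) ^ k < r"
    using assms by (intro real_arch_pow_inv) auto
  then obtain K where K: "1 / real b ^ K < r" by (auto simp: power_divide)
  define k where "k = (LEAST k. 1 / real b ^ k < r)"
  have k: "1 / real b ^ k < r" unfolding k_def using K by (rule LeastI)
  then have "k \<noteq> 0" using assms by (intro notI) simp
  then obtain j where j: "k = Suc j" using not0_implies_Suc by blast
  have "\<not> 1 / real b ^ j < r"
    using not_less_Least[of j "\<lambda>k. 1 / real b ^ k < r"] j unfolding k_def by simp
  then show ?thesis using that[of j] k unfolding j by simp
qed

section \<open>Comparison of balls of radii \<open>r\<close> and \<open>\<rho> * r\<close>\<close>

context bedford_mcmullen
begin

lemma row_diff_le:
  assumes "w \<in> Omega" "v \<in> Omega" "dist (code w) (code v) < r" "r \<le> 1 / real m ^ k"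
  shows "\<bar>int (row v k) - int (row w k)\<bar> \<le> 1"
proof -
  have "\<bar>expansion m (\<lambda>t. snd (v t)) - expansion m (\<lambda>t. snd (w t))\<bar> \<le> dist (code w) (code v)"
    using dist_snd_le[of "code w" "code v"] by (simp add: code_def dist_real_def abs_minus_commute)
  then show ?thesis unfolding row_def
    using assms by (intro word_value_diff_le[where r = r] two_le_m snd_less assms(1,2)) auto
qed

lemma column_diff_le:
  assumes "w \<in> Omega" "v \<in> Omega" "dist (code w) (code v) < r" "r \<le> 1 / real n ^ l"
  shows "\<bar>int (column v l) - int (column w l)\<bar> \<le> 1"
proof -
  have "\<bar>expansion n (\<lambda>t. fst (v t)) - expansion n (\<lambda>t. fst (w t))\<bar> \<le> dist (code w) (code v)"
    using dist_fst_le[of "code w" "code v"] by (simp add: code_def dist_real_def abs_minus_commute)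
  then show ?thesis unfolding column_def
    using assms by (intro word_value_diff_le[where r = r] two_le_n fst_less assms(1,2)) auto
qed

text \<open>Separates geometry from digits: for given centres only \<open>G\<close> remains to be
  found, a bound for the weights of rows near \<open>w\<close> relative to that of
  \<open>w'\<close>. The centres are quantified inside, so the same levels \<open>k\<close> and
  \<open>l\<close> serve all of them.\<close>

definition ball_ratio_bound :: "real \<Rightarrow> real \<Rightarrow> real \<Rightarrow> nat \<Rightarrow> nat \<Rightarrow> bool" where
  "ball_ratio_bound \<rho> C r k l \<longleftrightarrow> l \<le> k \<and> 1 / real m ^ Suc k < r \<and> r \<le> 1 / real m ^ k \<and>
    (\<forall>w w' G. w \<in> Omega \<longrightarrow> w' \<in> Omega \<longrightarrow> 0 \<le> G \<longrightarrow>
      (\<forall>v\<in>Omega. \<bar>int (row v k) - int (row w k)\<bar> \<le> 1 \<longrightarrow> weight v k l \<le> G * weight w' k l) \<longrightarrow>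
      measure bernoulli {v \<in> Omega. code v \<in> ball (code w) r}
        \<le> C * G * measure bernoulli {v \<in> Omega. code v \<in> ball (code w') (\<rho> * r)})"

text \<open>Nine squares of levels \<open>k\<close>, \<open>l\<close> cover the large ball, and the
  square of \<open>w'\<close> fits into the small ball after \<open>c\<close> further
  levels.\<close>

lemma prob_ball_ratio_le:
  assumes \<rho>: "0 < \<rho>"
  shows "\<exists>C\<ge>1. \<forall>r. 0 < r \<longrightarrow> r \<le> 1 \<longrightarrow> (\<exists>k l. ball_ratio_bound \<rho> C r k l)"
proof -
  \<comment> \<open>Each further level divides the sides by at least 2. The factor \<open>n\<close>
    absorbs the rounding of \<open>r\<close> to a power of the base, the factor 2 the sum of the two
    sides.\<close>
  obtain c where c: "2 * real n / \<rho> < 2 ^ c" using real_arch_pow[of 2 "2 * real n / \<rho>"] by auto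
  define C where "C = 9 * real (card D * n) ^ c"
  have base: "1 / real b ^ (j + c) < \<rho> * r / 2"
    if b: "2 \<le> b" "b \<le> n" and r: "1 / real b ^ Suc j < r" for b j r
  proof -
    have bc: "(2::real) ^ c \<le> real b ^ c" using b(1) by (intro power_mono) auto
    have "0 < 1 / real b ^ Suc j" using b(1) by simp
    then have r0: "0 < r" using r by (rule less_trans)
    have "2 * real n < \<rho> * 2 ^ c" using c \<rho> by (simp add: field_simps)
    then have "2 * real b < \<rho> * 2 ^ c" using b(2) by linarith
    also have "\<dots> \<le> \<rho> * real b ^ c" using bc \<rho> by simp
    finally have *: "real b / real b ^ c \<le> \<rho> / 2" using b(1) by (simp add: field_simps)
    have "1 / real b ^ (j + c) = real b / real b ^ c * (1 / real b ^ Suc j)"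
      using b(1) by (simp add: power_add)
    also have "\<dots> < real b / real b ^ c * r" using r b(1) by (intro mult_strict_left_mono) auto
    also have "\<dots> \<le> \<rho> / 2 * r" using * r0 by (intro mult_right_mono) auto
    finally show ?thesis by simp
  qed
  show ?thesis
  proof (intro exI[of _ C] conjI allI impI)
    have "1 \<le> card D * n" using card_D_pos two_le_n by (simp add: Suc_le_eq)
    then have "1 \<le> real (card D * n)" by (simp only: real_of_nat_ge_one_iff)
    then have "1 \<le> real (card D * n) ^ c" by (rule one_le_power)
    then show "1 \<le> C" unfolding C_def by linarith
    fix r :: real assume r: "0 < r" "r \<le> 1"
    obtain k where k: "1 / real m ^ Suc k < r" "r \<le> 1 / real m ^ k"
      using ex_power_scale[OF two_le_m r] .
    obtain l where l: "1 / real n ^ Suc l < r" "r \<le> 1 / real n ^ l"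
      using ex_power_scale[OF two_le_n r] .
    have lk: "l \<le> k"
    proof (rule ccontr)
      assume "\<not> l \<le> k"
      then have "Suc k \<le> l" by simp
      then have "real m ^ Suc k \<le> real n ^ l"
        using m_less_n two_le_m power_mono[of "real m" "real n" "Suc k"]
          power_increasing[of "Suc k" l "real n"] by linarith
      then have "1 / real n ^ l \<le> 1 / real m ^ Suc k"
        using two_le_m two_le_n by (intro divide_left_mono mult_pos_pos zero_less_power) auto
      then show False using k(1) l(2) by linarith
    qed
    have main: "measure bernoulli {v \<in> Omega. code v \<in> ball (code w) r}
          \<le> C * G * measure bernoulli {v \<in> Omega. code v \<in> ball (code w') (\<rho> * r)}"
      if w: "w \<in> Omega" "w' \<in> Omega" and G: "0 \<le> G"
        and le: "\<forall>v\<in>Omega. \<bar>int (row v k) - int (row w k)\<bar> \<le> 1 \<longrightarrow> weight v k l \<le> G * weight w' k l"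
      for w w' G
    proof -
      have "measure bernoulli {v \<in> Omega. code v \<in> ball (code w) r} \<le> 9 * (G * weight w' k l)"
      proof (rule prob_cover_le[OF _ lk])
        show "0 \<le> G * weight w' k l" using G weight_pos[OF w(2), of k l] by simp
        fix v assume v: "v \<in> Omega" "code v \<in> ball (code w) r"
        then have d: "dist (code w) (code v) < r" by simp
        have "\<bar>int (row v k) - int (row w k)\<bar> \<le> 1"
          by (rule row_diff_le[OF w(1) v(1) d k(2)])
        moreover have "\<bar>int (column v l) - int (column w l)\<bar> \<le> 1"
          by (rule column_diff_le[OF w(1) v(1) d l(2)])
        ultimately show "\<bar>int (column v l) - int (column w l)\<bar> \<le> 1
            \<and> \<bar>int (row v k) - int (row w k)\<bar> \<le> 1 \<and> weight v k l \<le> G * weight w' k l"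
          using le v(1) by blast
      qed simp
      also have "\<dots> \<le> 9 * (G * (real (card D * n) ^ c * measure bernoulli {v \<in> Omega. code v \<in> ball (code w') (\<rho> * r)}))"
      proof (intro mult_left_mono G)
        have "weight w' k l \<le> real (card D * n) ^ c * weight w' (k + c) (l + c)"
          by (rule weight_add_ge[OF w(2) lk])
        also have "\<dots> \<le> real (card D * n) ^ c * measure bernoulli {v \<in> Omega. code v \<in> ball (code w') (\<rho> * r)}"
        proof (intro mult_left_mono prob_ball_ge w(2))
          have "1 / real m ^ (k + c) < \<rho> * r / 2" using two_le_m m_less_n k(1) by (intro base) auto
          moreover have "1 / real n ^ (l + c) < \<rho> * r / 2" using two_le_n l(1) by (intro base) auto
          ultimately show "1 / real m ^ (k + c) + 1 / real n ^ (l + c) < \<rho> * r" by simp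
        qed (use lk in simp_all)
        finally show "weight w' k l \<le> real (card D * n) ^ c * measure bernoulli {v \<in> Omega. code v \<in> ball (code w') (\<rho> * r)}" .
      qed simp
      finally show ?thesis unfolding C_def by (simp only: mult.assoc mult.left_commute)
    qed
    show "\<exists>k l. ball_ratio_bound \<rho> C r k l"
      unfolding ball_ratio_bound_def using lk k main by blast
  qed
qed

section \<open>Carries between adjacent rows\<close>

lemma weight_le_of_digits:
  assumes "v \<in> Omega" "w \<in> Omega" "p < k" "1 \<le> G"
    and eq: "\<And>t. t < p \<Longrightarrow> snd (v t) = snd (w t)"
    and le: "\<And>t. p < t \<Longrightarrow> t < k \<Longrightarrow> real (fiber D (snd (v t))) \<le> G * real (fiber D (snd (w t)))"
  shows "weight v k l \<le> real n * G ^ (k - Suc p) * weight w k l"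
proof -
  \<comment> \<open>The fibers at the carry digit \<open>p\<close> are unrelated, hence the factor
    \<open>n\<close>; \<open>G\<close> controls only the digits after it.\<close>
  define g where "g t = (if t < p then 1 else if t = p then real n else G)" for t
  have g1: "1 \<le> g t" for t using assms(4) two_le_n by (simp add: g_def)
  have step: "real (fiber D (snd (v t))) \<le> g t * real (fiber D (snd (w t)))" if "t < k" for t
  proof -
    consider "t < p" | "t = p" | "p < t" by linarith
    then show ?thesis
    proof cases
      case 1
      then show ?thesis by (simp add: g_def eq)
    next
      case 2
      have "real (fiber D (snd (v p))) \<le> real n" using fiber_le by simp
      also have "\<dots> \<le> real n * real (fiber D (snd (w p)))"
        using fiber_digit_ge_1[OF assms(2), of p] two_le_n by simp
      finally show ?thesis using 2 by (simp add: g_def)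
    next
      case 3
      then show ?thesis using le[OF 3 that] by (simp add: g_def)
    qed
  qed
  have "(\<Prod>t\<in>{l..<k}. real (fiber D (snd (v t)))) \<le> (\<Prod>t\<in>{l..<k}. g t * real (fiber D (snd (w t))))"
    by (intro prod_mono conjI step) auto
  also have "\<dots> = (\<Prod>t\<in>{l..<k}. g t) * (\<Prod>t\<in>{l..<k}. real (fiber D (snd (w t))))"
    by (rule prod.distrib)
  \<comment> \<open>All factors are at least 1, so the window may start at 0. This makes the bound
    independent of the position of \<open>l\<close> relative to \<open>p\<close>.\<close>
  also have "\<dots> \<le> (\<Prod>t\<in>{..<k}. g t) * (\<Prod>t\<in>{l..<k}. real (fiber D (snd (w t))))"
  proof (intro mult_right_mono prod_nonneg)
    show "(\<Prod>t\<in>{l..<k}. g t) \<le> (\<Prod>t\<in>{..<k}. g t)"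
      using g1 by (intro prod_mono2) (auto intro: order_trans[OF zero_le_one])
  qed simp
  also have "(\<Prod>t\<in>{..<k}. g t) = real n * G ^ (k - Suc p)"
  proof -
    have "{..<k} = {..<p} \<union> {p} \<union> {Suc p..<k}" using assms(3) by auto
    then have "(\<Prod>t\<in>{..<k}. g t) = prod g ({..<p} \<union> {p} \<union> {Suc p..<k})" by (simp only:)
    also have "\<dots> = prod g ({..<p} \<union> {p}) * (\<Prod>t\<in>{Suc p..<k}. g t)"
      by (rule prod.union_disjoint) auto
    also have "prod g ({..<p} \<union> {p}) = (\<Prod>t\<in>{..<p}. g t) * g p"
      by (subst prod.union_disjoint) auto
    also have "(\<Prod>t\<in>{..<p}. g t) * g p * (\<Prod>t\<in>{Suc p..<k}. g t) = real n * (\<Prod>t\<in>{Suc p..<k}. G)"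
      by (simp add: g_def)
    finally show ?thesis by simp
  qed
  finally have "(\<Prod>t\<in>{l..<k}. real (fiber D (snd (v t)))) / real (card D) ^ k
      \<le> real n * G ^ (k - Suc p) * (\<Prod>t\<in>{l..<k}. real (fiber D (snd (w t)))) / real (card D) ^ k"
    by (rule divide_right_mono) simp
  then show ?thesis unfolding weight_def by simp
qed

lemma weight_row_cong:
  assumes "v \<in> Omega" "w \<in> Omega" "row v k = row w k"
  shows "weight v k l = weight w k l"
proof -
  have "\<forall>t<k. snd (v t) = snd (w t)" using row_eq_iff[OF assms(1,2)] assms(3) by blast
  then show ?thesis unfolding weight_def by simp
qed

text \<open>The first two alternatives are the doubling cases: they rule out nontrivial carries
  between nonempty rows, so that \<open>G = 1\<close> is allowed.\<close>

definition ratio_bound :: "real \<Rightarrow> bool" where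
  "ratio_bound G \<longleftrightarrow> 1 \<le> G \<and> fiber D (m - 1) \<le> fiber D 0 \<and>
    (fiber D (m - 1) = 0 \<or> (\<forall>j<m - 1. fiber D j * fiber D (j + 1) = 0)
      \<or> real (fiber D 0) \<le> G * real (fiber D (m - 1)))"

text \<open>The two bounds are asymmetric: after the carry the upper row has zeros where the lower
  one has digits \<open>m - 1\<close>, and \<open>fiber D (m - 1) \<le> fiber D 0\<close>, so only
  the upper row can be heavier by more than a constant.\<close>

lemma adjacent_weights:
  assumes v: "v \<in> Omega" and w: "w \<in> Omega" and Suc: "row v k = Suc (row w k)"
    and G: "ratio_bound G"
  obtains q where "q \<le> k" "\<And>t. k - q \<le> t \<Longrightarrow> t < k \<Longrightarrow> snd (w t) = m - 1 \<and> snd (v t) = 0"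
    "\<And>l. weight v k l \<le> real n * G ^ q * weight w k l" "\<And>l. weight w k l \<le> real n * weight v k l"
proof -
  obtain p where p: "p < k" "\<And>t. t < p \<Longrightarrow> snd (w t) = snd (v t)" "snd (v p) = Suc (snd (w p))"
    and tail: "\<And>t. p < t \<Longrightarrow> t < k \<Longrightarrow> snd (w t) = m - 1 \<and> snd (v t) = 0"
    using word_value_Suc_eqD[OF Suc[unfolded row_def] snd_less[OF w] snd_less[OF v]] by blast
  have G1: "1 \<le> G" and le0: "fiber D (m - 1) \<le> fiber D 0" using G unfolding ratio_bound_def by blast+
  have lt: "snd (w p) < m - 1" using p(3) snd_less[OF v, of p] by linarith
  \<comment> \<open>The carry digit exhibits two adjacent nonempty rows, which rules out the second
    alternative of \<open>ratio_bound\<close>. A digit \<open>m - 1\<close> of \<open>w\<close>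
    after it rules out the first.\<close>
  have "0 < fiber D (snd (w p)) * fiber D (snd (w p) + 1)"
    using fiber_digit_ge_1[OF w, of p] fiber_digit_ge_1[OF v, of p] p(3) by simp
  with lt have nadj: "\<not> (\<forall>j<m - 1. fiber D j * fiber D (j + 1) = 0)" by fastforce
  have f0: "real (fiber D (snd (v t))) \<le> G * real (fiber D (snd (w t)))" if "p < t" "t < k" for t
  proof -
    have "1 \<le> fiber D (m - 1)" using fiber_digit_ge_1[OF w, of t] tail[OF that] by simp
    then show ?thesis using G nadj tail[OF that] unfolding ratio_bound_def by auto
  qed
  have f1: "real (fiber D (snd (w t))) \<le> 1 * real (fiber D (snd (v t)))" if "p < t" "t < k" for t
    using tail[OF that] le0 by simp
  show thesis
  proof (rule that[of "k - Suc p"])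
    show "snd (w t) = m - 1 \<and> snd (v t) = 0" if "k - (k - Suc p) \<le> t" "t < k" for t
      using that p(1) by (intro tail) auto
    show "weight v k l \<le> real n * G ^ (k - Suc p) * weight w k l" for l
      by (rule weight_le_of_digits[OF v w p(1) G1 _ f0]) (use p(2) in auto)
    have "weight w k l \<le> real n * 1 ^ (k - Suc p) * weight v k l" for l
      by (rule weight_le_of_digits[OF w v p(1) _ _ f1]) (use p(2) in auto)
    then show "weight w k l \<le> real n * weight v k l" for l by simp
  qed simp
qed

text \<open>The run is read off the centre \<open>w\<close>: its neighbour \<open>v\<close> can be
  much heavier only from above, and then \<open>w\<close> is the row that ends in digits
  \<open>m - 1\<close>.\<close>

lemma weight_le_above:
  assumes v: "v \<in> Omega" and w: "w \<in> Omega" and adj: "\<bar>int (row v k) - int (row w k)\<bar> \<le> 1"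
    and G: "ratio_bound G"
  obtains q where "q \<le> k" "\<And>t. k - q \<le> t \<Longrightarrow> t < k \<Longrightarrow> snd (w t) = m - 1"
    "weight v k l \<le> real n * G ^ q * weight w k l"
proof -
  have pos: "0 < weight w k l" by (rule weight_pos[OF w])
  have n1: "weight w k l \<le> real n * weight w k l" using pos two_le_n by simp
  consider "row v k = row w k" | "row w k = Suc (row v k)" | "row v k = Suc (row w k)"
    using adj by linarith
  then show thesis
  proof cases
    case 1
    then show thesis using that[of 0] weight_row_cong[OF v w 1] n1 by simp
  next
    case 2
    obtain q where "weight v k l \<le> real n * weight w k l"
      using adjacent_weights[OF w v 2 G] by blast
    then show thesis using that[of 0] by simp
  next
    case 3
    show thesis by (rule adjacent_weights[OF v w 3 G]) (use that in blast)
  qed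
qed

text \<open>The mirror case: \<open>w\<close> can be much heavier than \<open>v\<close> only if
  \<open>v\<close> lies below, and then \<open>w\<close> is the row that ends in zeros.\<close>

lemma weight_le_below:
  assumes v: "v \<in> Omega" and w: "w \<in> Omega" and adj: "\<bar>int (row v k) - int (row w k)\<bar> \<le> 1"
    and G: "ratio_bound G"
  obtains q where "q \<le> k" "\<And>t. k - q \<le> t \<Longrightarrow> t < k \<Longrightarrow> snd (w t) = 0"
    "weight w k l \<le> real n * G ^ q * weight v k l"
proof -
  have pos: "0 < weight w k l" by (rule weight_pos[OF w])
  have n1: "weight w k l \<le> real n * weight w k l" using pos two_le_n by simp
  consider "row v k = row w k" | "row w k = Suc (row v k)" | "row v k = Suc (row w k)"
    using adj by linarith
  then show thesis
  proof cases
    case 1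
    then show thesis using that[of 0] weight_row_cong[OF v w 1] n1 by simp
  next
    case 2
    show thesis by (rule adjacent_weights[OF w v 2 G]) (use that in blast)
  next
    case 3
    obtain q where "weight w k l \<le> real n * weight v k l"
      using adjacent_weights[OF v w 3 G] by blast
    then show thesis using that[of 0] by simp
  qed
qed

definition run_bound :: "(nat \<Rightarrow> nat) \<Rightarrow> nat \<Rightarrow> real \<Rightarrow> bool" where
  "run_bound f k b \<longleftrightarrow> (\<forall>q\<le>k. (\<forall>t\<in>{k - q..<k}. f t = 0) \<or> (\<forall>t\<in>{k - q..<k}. f t = m - 1) \<longrightarrow> real q \<le> b)"

text \<open>Only one of the two factors contributes: the last digit of \<open>w\<close> cannot be both \<open>0\<close> and
  \<open>m - 1\<close>, so a nontrivial carry can occur in only one direction.\<close>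

lemma weight_compare:
  assumes v: "v \<in> Omega" "\<bar>int (row v k) - int (row w k)\<bar> \<le> 1"
    and v': "v' \<in> Omega" "\<bar>int (row v' k) - int (row w k)\<bar> \<le> 1"
    and w: "w \<in> Omega" and G: "ratio_bound G" and run: "run_bound (\<lambda>t. snd (w t)) k b"
  shows "weight v k l \<le> (real n)\<^sup>2 * G powr b * weight v' k l"
proof -
  have G1: "1 \<le> G" using G by (simp add: ratio_bound_def)
  obtain q where q: "q \<le> k" "\<And>t. k - q \<le> t \<Longrightarrow> t < k \<Longrightarrow> snd (w t) = m - 1"
    "weight v k l \<le> real n * G ^ q * weight w k l"
    using weight_le_above[OF v(1) w v(2) G] by blast
  obtain q' where q': "q' \<le> k" "\<And>t. k - q' \<le> t \<Longrightarrow> t < k \<Longrightarrow> snd (w t) = 0"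
    "weight w k l \<le> real n * G ^ q' * weight v' k l"
    using weight_le_below[OF v'(1) w v'(2) G] by blast
  have "q = 0 \<or> q' = 0"
  proof (rule ccontr)
    assume "\<not> (q = 0 \<or> q' = 0)"
    then have "snd (w (k - 1)) = m - 1" "snd (w (k - 1)) = 0"
      using q(1) q'(1) by (intro q(2) q'(2); linarith)+
    then show False using two_le_m by simp
  qed
  moreover have "real q \<le> b" "real q' \<le> b"
    using run q(1,2) q'(1,2) unfolding run_bound_def by auto
  ultimately have "real (q + q') \<le> b" by auto
  then have Gb: "G ^ (q + q') \<le> G powr b"
    using G1 powr_mono[of "real (q + q')" b G] by (simp only: powr_realpow)
  have "weight v k l \<le> real n * G ^ q * (real n * G ^ q' * weight v' k l)"
    using q(3) by (rule order_trans) (intro mult_left_mono q'(3), use G1 in simp)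
  also have "\<dots> = (real n)\<^sup>2 * G ^ (q + q') * weight v' k l"
    by (simp add: power2_eq_square power_add)
  also have "\<dots> \<le> (real n)\<^sup>2 * G powr b * weight v' k l"
    using Gb weight_pos[OF v'(1), of k l] by (intro mult_right_mono mult_left_mono) auto
  finally show ?thesis .
qed

text \<open>With \<open>G = 1\<close> runs contribute nothing, so small radii have a uniform
  constant. A large ball contains a square of fixed level, which bounds its mass from below.\<close>

lemma doubling_if:
  assumes "ratio_bound 1"
  shows "doubling_measure mu"
proof -
  interpret mu: prob_space mu by (rule prob_space_mu)
  have half: "0 < (1/2 :: real)" by simp
  obtain C where C: "1 \<le> C" "\<And>r. 0 < r \<Longrightarrow> r \<le> 1 \<Longrightarrow> \<exists>k l. ball_ratio_bound (1/2) C r k l"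
    using prob_ball_ratio_le[OF half] by blast
  define K where "K = max (C * (real n)) (real (card D) ^ 3)"
  have K: "measure mu (ball z (2 * r)) \<le> K * measure mu (ball z r)" "0 < measure mu (ball z r)"
    if z: "z \<in> measure_support mu" and r: "0 < r" for z r
  proof -
    obtain w where w: "w \<in> Omega" "z = code w" using z measure_support_mu by blast
    show "0 < measure mu (ball z r)"
    proof -
      have "0 < emeasure mu (ball z r)" using z r unfolding measure_support_def by blast
      then show ?thesis by (simp add: mu.emeasure_eq_measure)
    qed
    show "measure mu (ball z (2 * r)) \<le> K * measure mu (ball z r)"
    proof (cases "2 * r \<le> 1")
      case True
      have r2: "0 < 2 * r" using r by simp
      obtain k l where kl: "ball_ratio_bound (1/2) C (2 * r) k l"
        using C(2)[OF r2 True] by blast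
      have "\<forall>v\<in>Omega. \<bar>int (row v k) - int (row w k)\<bar> \<le> 1 \<longrightarrow> weight v k l \<le> real n * weight w k l"
      proof (intro ballI impI)
        fix v assume v: "v \<in> Omega" "\<bar>int (row v k) - int (row w k)\<bar> \<le> 1"
        obtain q where "weight v k l \<le> real n * 1 ^ q * weight w k l"
          using weight_le_above[OF v(1) w(1) v(2) assms] by blast
        then show "weight v k l \<le> real n * weight w k l" by simp
      qed
      then have "measure bernoulli {v \<in> Omega. code v \<in> ball (code w) (2 * r)}
          \<le> C * real n * measure bernoulli {v \<in> Omega. code v \<in> ball (code w) (1/2 * (2 * r))}"
        using kl w(1) of_nat_0_le_iff unfolding ball_ratio_bound_def by blast
      then have "measure mu (ball z (2 * r)) \<le> C * real n * measure mu (ball z r)"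
        by (simp add: measure_mu w(2))
      also have "\<dots> \<le> K * measure mu (ball z r)" unfolding K_def by (intro mult_right_mono) auto
      finally show ?thesis .
    next
      case False
      \<comment> \<open>Here \<open>r > 1/2\<close>, and level 3 is deep enough because the two
        sides add up to at most \<open>1/8 + 1/8\<close>. With both levels equal, the square is a
        cylinder of mass \<open>1 / card D ^ 3\<close>.\<close>
      have cube: "1 / real b ^ 3 \<le> 1 / 2 ^ 3" if "2 \<le> b" for b :: nat
        using that by (intro divide_left_mono power_mono mult_pos_pos zero_less_power) auto
      have "1 / real m ^ 3 + 1 / real n ^ 3 < r"
        using False cube[OF two_le_m] cube[OF two_le_n] by simp
      then have "weight w 3 3 \<le> measure mu (ball z r)"
        using prob_ball_ge[OF w(1), of 3 3 r] by (simp add: measure_mu w(2))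
      then have "1 / real (card D) ^ 3 \<le> measure mu (ball z r)" by (simp add: weight_def)
      then have "1 \<le> real (card D) ^ 3 * measure mu (ball z r)"
        using card_D_pos by (simp add: divide_le_eq mult.commute)
      also have "\<dots> \<le> K * measure mu (ball z r)" unfolding K_def by (intro mult_right_mono) auto
      finally have "1 \<le> K * measure mu (ball z r)" .
      with mu.prob_le_1 show ?thesis by (rule order_trans)
    qed
  qed
  have K0: "0 \<le> K" unfolding K_def by (simp add: max.coboundedI2)
  have "(SUP (x, r) \<in> measure_support mu \<times> {0<..}. emeasure mu (ball x (2 * r)) / emeasure mu (ball x r)) \<le> ennreal K"
  proof (rule SUP_least, clarify)
    fix x y r :: real assume "(x, y) \<in> measure_support mu" "r > 0"
    note * = K[OF this]
    show "emeasure mu (ball (x, y) (2 * r)) / emeasure mu (ball (x, y) r) \<le> ennreal K"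
      unfolding mu.emeasure_eq_measure using * K0
      by (simp add: divide_ennreal divide_le_eq)
  qed
  also have "ennreal K < \<infinity>" by simp
  finally show ?thesis unfolding doubling_measure_def .
qed

text \<open>Contraposition of \<open>doubling_if\<close>: failure of the degenerate alternatives in
  \<open>ratio_bound\<close> supplies the digits needed for a carry.\<close>

lemma non_doubling_typeD:
  assumes "non_doubling_type n m D" "fiber D (m - 1) < fiber D 0"
  shows "0 < fiber D (m - 1)" "\<exists>j<m - 1. 0 < fiber D j \<and> 0 < fiber D (j + 1)"
proof -
  have "\<not> ratio_bound 1"
    using assms(1) doubling_if unfolding non_doubling_type_def carpet_measure_eq by blast
  then show "0 < fiber D (m - 1)" "\<exists>j<m - 1. 0 < fiber D j \<and> 0 < fiber D (j + 1)"
    using assms(2) unfolding ratio_bound_def by auto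
qed

end

section \<open>Runs of digits in random expansions\<close>

text \<open>The second Borel-Cantelli lemma. Independence and \<open>1 - p \<le> exp (- p)\<close>
  bound the probability of no success after \<open>N\<close> by the exponential of a negative
  partial sum; were it positive, the partial sums would be bounded.\<close>

lemma (in prob_space) AE_infinitely_often:
  assumes Y: "indep_vars (\<lambda>_ :: nat. count_space UNIV) Y UNIV"
    and ns: "\<not> summable (\<lambda>i. prob {x \<in> space M. Y i x})"
  shows "AE x in M. \<exists>\<^sub>\<infinity>i. Y i x"
proof -
  define p where "p i = prob {x \<in> space M. Y i x}" for i
  have rv: "Y i \<in> measurable M (count_space UNIV)" for i
    using Y unfolding indep_vars_def by blast
  have ev: "{x \<in> space M. Y i x} \<in> events" "{x \<in> space M. \<not> Y i x} \<in> events" for i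
    using rv[of i] by measurable
  have compl: "prob {x \<in> space M. \<not> Y i x} = 1 - p i" for i
    using prob_neg[OF ev(1)[of i]] by (simp add: p_def)
  have N: "AE x in M. \<exists>i\<ge>N. Y i x" for N
  proof -
    define F where "F = {x \<in> space M. \<forall>i\<ge>N. \<not> Y i x}"
    have F: "F \<in> events"
    proof -
      have "F = space M - (\<Union>i\<in>{N..}. {x \<in> space M. Y i x})" unfolding F_def by auto
      moreover have "(\<Union>i\<in>{N..}. {x \<in> space M. Y i x}) \<in> events"
        by (intro sets.countable_UN' image_subsetI ev(1)) simp
      ultimately show ?thesis by (simp only: sets.compl_sets)
    qed
    have le: "prob F \<le> exp (- (\<Sum>i\<in>{N..<k}. p i))" if k: "N < k" for k
    proof -
      have "prob F \<le> prob (\<Inter>i\<in>{N..<k}. Y i -` {False} \<inter> space M)"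
      proof (rule finite_measure_mono)
        show "F \<subseteq> (\<Inter>i\<in>{N..<k}. Y i -` {False} \<inter> space M)" unfolding F_def by (intro subsetI INT_I IntI vimageI2) simp_all
        show "(\<Inter>i\<in>{N..<k}. Y i -` {False} \<inter> space M) \<in> events"
          using k by (intro sets.finite_INT measurable_sets[OF rv]) simp_all
      qed
      also have "\<dots> = (\<Prod>i\<in>{N..<k}. prob (Y i -` {False} \<inter> space M))"
        using k by (intro indep_varsD[OF Y]) auto
      also have "\<dots> = (\<Prod>i\<in>{N..<k}. 1 - p i)"
      proof (rule prod.cong)
        fix i
        have "Y i -` {False} \<inter> space M = {x \<in> space M. \<not> Y i x}" by auto
        then show "prob (Y i -` {False} \<inter> space M) = 1 - p i" using compl by simp
      qed simp
      also have "\<dots> \<le> (\<Prod>i\<in>{N..<k}. exp (- p i))"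
      proof (rule prod_mono)
        fix i
        show "0 \<le> 1 - p i \<and> 1 - p i \<le> exp (- p i)"
          using exp_ge_add_one_self[of "- p i"] by (simp add: p_def)
      qed
      also have "\<dots> = exp (- (\<Sum>i\<in>{N..<k}. p i))" by (simp add: exp_sum flip: sum_negf)
      finally show ?thesis .
    qed
    have "prob F = 0"
    proof (rule ccontr)
      assume "prob F \<noteq> 0"
      then have pos: "0 < prob F" by (simp add: zero_less_measure_iff)
      have p0: "0 \<le> p i" for i by (simp add: p_def)
      have "(\<Sum>i<k. p i) \<le> (\<Sum>i<N. p i) - ln (prob F)" for k
      proof (cases "N < k")
        case True
        have "ln (prob F) \<le> ln (exp (- (\<Sum>i\<in>{N..<k}. p i)))"
          using le[OF True] pos by (intro ln_mono) auto
        moreover have "(\<Sum>i<k. p i) = (\<Sum>i<N. p i) + (\<Sum>i\<in>{N..<k}. p i)"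
          using True by (simp add: sum.atLeastLessThan_concat lessThan_atLeast0)
        ultimately show ?thesis by simp
      next
        case False
        have "(\<Sum>i<k. p i) \<le> (\<Sum>i<N. p i)" using False p0 by (intro sum_mono2) auto
        moreover have "ln (prob F) \<le> 0" using pos by simp
        ultimately show ?thesis by simp
      qed
      then have "(\<Sum>i\<le>k. p i) \<le> (\<Sum>i<N. p i) - ln (prob F)" for k
        by (simp only: flip: lessThan_Suc_atMost)
      then have "summable p" by (rule bounded_imp_summable[OF p0])
      with ns show False by (simp add: p_def[abs_def])
    qed
    then have "AE x in M. x \<notin> F" using F by (simp add: prob_eq_0)
    with AE_space[of M] show ?thesis by eventually_elim (auto simp: F_def)
  qed
  then have "AE x in M. \<forall>N. \<exists>i\<ge>N. Y i x" by (simp add: AE_all_countable)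
  then show ?thesis by (simp add: INFM_nat_le)
qed

lemma (in product_prob_space) indep_vars_component:
  assumes "I = UNIV"
  shows "indep_vars M (\<lambda>i \<omega>. \<omega> i) I"
proof -
  have rv: "(\<lambda>\<omega>. \<omega> i) \<in> measurable (PiM I M) (M i)" for i using assms by simp
  have "distr (PiM I M) (PiM I M) (\<lambda>x. \<lambda>i\<in>I. x i) = distr (PiM I M) (PiM I M) (\<lambda>x. x)"
    using assms by (intro distr_cong) auto
  also have "\<dots> = PiM I M" by simp
  also have "\<dots> = PiM I (\<lambda>i. distr (PiM I M) (M i) (\<lambda>\<omega>. \<omega> i))"
    using PiM_component by (intro PiM_cong) auto
  finally show ?thesis
    using assms by (subst indep_vars_iff_distr_eq_PiM[OF _ rv]) auto
qed

locale gap_carpet = bedford_mcmullen +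
  fixes j :: nat
  assumes top_pos: "0 < fiber D (m - 1)" and top_less: "fiber D (m - 1) < fiber D 0"
    and j_less: "j < m - 1" and j_pos: "0 < fiber D j" and Suc_j_pos: "0 < fiber D (Suc j)"
begin

lemma fiber_0_less_card: "fiber D 0 < card D"
proof -
  have "fiber D 0 + fiber D (m - 1) = card ({d \<in> D. snd d = 0} \<union> {d \<in> D. snd d = m - 1})"
    unfolding card_row[symmetric] using two_le_m by (intro card_Un_disjoint[symmetric]) auto
  also have "\<dots> \<le> card D" by (intro card_mono) auto
  finally show ?thesis using top_pos by simp
qed

text \<open>Normalised so that a run of \<open>run_const * ln x\<close> zeros has probability
  \<open>1 / x\<close>, as made precise in \<open>powr_run_const\<close>.\<close>

definition run_const :: real where
  "run_const = 1 / ln (real (card D) / real (fiber D 0))"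

lemma run_const_pos: "0 < run_const"
  unfolding run_const_def using fiber_0_less_card top_less by simp

lemma powr_run_const:
  assumes "0 < x"
  shows "(real (fiber D 0) / real (card D)) powr (a * run_const * ln x) = x powr (- a)"
proof -
  have f0: "0 < real (fiber D 0)" using top_less by simp
  have L: "0 < ln (real (card D) / real (fiber D 0))" using fiber_0_less_card f0 by simp
  have "ln (real (fiber D 0) / real (card D)) = - ln (real (card D) / real (fiber D 0))"
    using f0 card_D_pos by (simp add: ln_div)
  then have "run_const * ln (real (fiber D 0) / real (card D)) = -1"
    unfolding run_const_def using L by simp
  then have "a * run_const * ln x * ln (real (fiber D 0) / real (card D)) = - a * ln x"
    by (metis mult.assoc mult.commute mult_minus1_right mult_minus_left)
  then show ?thesis using assms f0 D_nonempty unfolding powr_def by simp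
qed

lemma cylinder_measurable:
  assumes "finite J"
  shows "{w \<in> Omega. \<forall>t\<in>J. P t (w t)} \<in> sets bernoulli"
proof -
  have "{w \<in> space bernoulli. \<forall>t\<in>J. P t (w t)} \<in> sets bernoulli"
  proof (rule sets.sets_Collect_finite_All[OF _ assms])
    fix t
    have "(\<lambda>w. P t (w t)) \<in> measurable bernoulli (count_space UNIV)"
      by (rule digit_measurable)
    then show "{w \<in> space bernoulli. P t (w t)} \<in> sets bernoulli" by measurable
  qed
  then show ?thesis unfolding space_bernoulli .
qed

lemma prob_digits:
  assumes "finite J"
  shows "measure bernoulli {w \<in> Omega. \<forall>t\<in>J. snd (w t) = c t}
      = (\<Prod>t\<in>J. real (fiber D (c t)) / real (card D))"
proof -
  have "{w \<in> Omega. \<forall>t\<in>J. snd (w t) = c t} = {w \<in> Omega. \<forall>t\<in>J. w t \<in> {d \<in> D. snd d = c t}}"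
    using OmegaD by blast
  then show ?thesis using prob_cylinder[OF assms, of "\<lambda>t. {d \<in> D. snd d = c t}"]
    by (simp add: card_row)
qed

text \<open>By the first Borel-Cantelli lemma: a run longer than the bound ends at \<open>k\<close>
  with probability at most \<open>k powr (- (1 + e))\<close>, which is summable. Runs of digits
  \<open>m - 1\<close> obey the same estimate because their fiber is smaller.\<close>

lemma AE_run_bound:
  assumes "0 < e"
  shows "AE w in bernoulli. \<forall>\<^sub>F k in sequentially. run_bound (\<lambda>t. snd (w t)) k ((1 + e) * run_const * ln (real k))"
proof -
  define p where "p = real (fiber D 0) / real (card D)"
  have p: "0 < p" "p < 1" using top_less fiber_0_less_card unfolding p_def by auto
  define b where "b k = (1 + e) * run_const * ln (real k)" for k
  define q where "q k = Suc (nat \<lfloor>b k\<rfloor>)" for k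
  \<comment> \<open>\<open>q k\<close> is the least integer above \<open>b k\<close>, so every
    forbidden run contains one of this length. The second factor empties the event when
    \<open>k - q k\<close> would truncate.\<close>
  define A where "A c k = {w \<in> Omega. \<forall>t\<in>{k - q k..<k}. snd (w t) = c} \<inter> (if q k \<le> k then Omega else {})" for c k
  have A: "A c k \<in> sets bernoulli" for c k
    unfolding A_def using cylinder_measurable[of "{k - q k..<k}" "\<lambda>t d. snd d = c"]
      sets.top[of bernoulli] by (intro sets.Int) (auto simp del: sets.top)
  have le: "measure bernoulli (A c k) \<le> real k powr (- (1 + e))"
    if c: "c = 0 \<or> c = m - 1" and k: "k \<noteq> 0" for c k
  proof (cases "q k \<le> k")
    case True
    have "measure bernoulli (A c k) \<le> measure bernoulli {w \<in> Omega. \<forall>t\<in>{k - q k..<k}. snd (w t) = c}"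
      by (intro B.P.finite_measure_mono cylinder_measurable) (auto simp: A_def)
    also have "\<dots> = (real (fiber D c) / real (card D)) ^ q k"
      using True by (subst prob_digits) auto
    also have "\<dots> \<le> p ^ q k"
      unfolding p_def using c top_less by (intro power_mono divide_right_mono) auto
    also have "\<dots> = p powr real (q k)" using p by (simp add: powr_realpow)
    also have "\<dots> \<le> p powr b k"
    proof (rule powr_mono')
      show "b k \<le> real (q k)" unfolding q_def by linarith
    qed (use p in auto)
    also have "\<dots> = real k powr (- (1 + e))"
      unfolding p_def b_def using k by (intro powr_run_const) simp
    finally show ?thesis .
  next
    case False
    then show ?thesis by (simp add: A_def)
  qed
  have sum: "summable (\<lambda>k. measure bernoulli (A c k))" if c: "c = 0 \<or> c = m - 1" for c
  proof (rule summable_comparison_test_ev)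
    show "\<forall>\<^sub>F k in sequentially. norm (measure bernoulli (A c k)) \<le> real k powr (- (1 + e))"
      using eventually_gt_at_top[of 0]
    proof eventually_elim
      case (elim k)
      then show ?case using le[OF c, of k] by simp
    qed
    show "summable (\<lambda>k. real k powr (- (1 + e)))"
      using assms by (subst summable_real_powr_iff) simp
  qed
  have AE: "AE w in bernoulli. \<forall>\<^sub>F k in sequentially. w \<in> space bernoulli - A c k" if "c = 0 \<or> c = m - 1" for c
    by (rule borel_cantelli_AE1[OF A _ sum[OF that]]) (simp add: less_top[symmetric])
  have 0: "AE w in bernoulli. \<forall>\<^sub>F k in sequentially. w \<in> space bernoulli - A 0 k" using AE by blast
  have 1: "AE w in bernoulli. \<forall>\<^sub>F k in sequentially. w \<in> space bernoulli - A (m - 1) k" using AE by blast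
  from 0 1 show ?thesis
  proof eventually_elim
    case (elim w)
    from elim(1,2) eventually_gt_at_top[of 0]
    show ?case
    proof eventually_elim
      case (elim k)
      have b0: "0 \<le> b k" unfolding b_def using elim(3) assms run_const_pos by simp
      have w: "w \<in> Omega" using elim(1) by simp
      have no: "real l \<le> b k" if l: "l \<le> k" "\<forall>t\<in>{k - l..<k}. snd (w t) = c" "w \<notin> A c k" for l c
      proof (rule ccontr)
        assume "\<not> real l \<le> b k"
        then have "q k \<le> l" unfolding q_def using b0 by linarith
        then have "w \<in> A c k" unfolding A_def using l(1,2) w by auto
        with l(3) show False by simp
      qed
      have nA: "w \<notin> A 0 k" "w \<notin> A (m - 1) k" using elim(1,2) by auto
      show ?case unfolding run_bound_def b_def[symmetric]
        using no[OF _ _ nA(1)] no[OF _ _ nA(2)] by blast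
    qed
  qed
qed

text \<open>With this length, block \<open>i\<close> carries the pattern with probability at least a constant times
  \<open>1 / Suc i\<close>, which is just not summable, while \<open>ln (block_start i) \<sim> ln i\<close>. The factor \<open>i\<close> in
  \<open>block_start\<close> makes the blocks disjoint.\<close>

definition run_length :: "nat \<Rightarrow> nat" where
  "run_length i = nat \<lfloor>run_const * ln (real (Suc i))\<rfloor>"

definition block_start :: "nat \<Rightarrow> nat" where
  "block_start i = i * Suc (run_length i)"

text \<open>The row just below a digit \<open>Suc j\<close> followed by zeros reads \<open>j\<close>
  followed by digits \<open>m - 1\<close>, and both words use nonempty rows only. So the light
  neighbour exists in the carpet.\<close>

definition carry_pattern :: "(nat \<Rightarrow> nat) \<Rightarrow> nat \<Rightarrow> bool" where
  "carry_pattern f i \<longleftrightarrow> (\<forall>t\<in>{block_start i..block_start i + run_length i}.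
      f t = (if t = block_start i then Suc j else 0))"

lemma run_length_mono: "i \<le> i' \<Longrightarrow> run_length i \<le> run_length i'"
  unfolding run_length_def using run_const_pos by (intro nat_mono floor_mono mult_left_mono) auto

lemma block_end_less:
  assumes "i < i'"
  shows "block_start i + run_length i < block_start i'"
proof -
  have "block_start i + run_length i < Suc i * Suc (run_length i)"
    by (simp add: block_start_def)
  also have "\<dots> \<le> i' * Suc (run_length i')"
    using assms run_length_mono[of i i'] by (intro mult_le_mono) auto
  finally show ?thesis by (simp only: block_start_def)
qed

lemma disjoint_blocks: "disjoint_family (\<lambda>i. {block_start i..block_start i + run_length i})"
  unfolding disjoint_family_on_def
proof (intro ballI impI)
  fix i i' :: nat assume "i \<noteq> i'"
  then consider "i < i'" | "i' < i" by linarith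
  then show "{block_start i..block_start i + run_length i} \<inter> {block_start i'..block_start i' + run_length i'} = {}"
    by cases (use block_end_less[of i i'] block_end_less[of i' i] in auto)
qed

lemma prob_carry_pattern_ge:
  "real (fiber D (Suc j)) / real (card D) * (1 / real (Suc i))
    \<le> measure bernoulli {w \<in> Omega. carry_pattern (\<lambda>t. snd (w t)) i}"
proof -
  define p where "p = real (fiber D 0) / real (card D)"
  have p: "0 < p" "p < 1" using top_less fiber_0_less_card unfolding p_def by auto
  let ?J = "{block_start i..block_start i + run_length i}"
  have J: "?J = insert (block_start i) {Suc (block_start i)..block_start i + run_length i}" by auto
  have "measure bernoulli {w \<in> Omega. carry_pattern (\<lambda>t. snd (w t)) i}
      = (\<Prod>t\<in>?J. real (fiber D (if t = block_start i then Suc j else 0)) / real (card D))"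
    unfolding carry_pattern_def by (rule prob_digits) simp
  also have "\<dots> = real (fiber D (Suc j)) / real (card D) * (\<Prod>t\<in>{Suc (block_start i)..block_start i + run_length i}. p)"
    unfolding J by (subst prod.insert) (auto simp: p_def intro!: prod.cong)
  also have "(\<Prod>t\<in>{Suc (block_start i)..block_start i + run_length i}. p) = p ^ run_length i"
    by simp
  finally have eq: "measure bernoulli {w \<in> Omega. carry_pattern (\<lambda>t. snd (w t)) i}
    = real (fiber D (Suc j)) / real (card D) * p ^ run_length i" .
  have "1 / real (Suc i) = real (Suc i) powr (- 1)" by (simp add: powr_minus_divide)
  also have "\<dots> = p powr (1 * run_const * ln (real (Suc i)))"
    unfolding p_def by (rule powr_run_const[symmetric]) simp
  also have "\<dots> \<le> p powr (real (run_length i))"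
  proof (rule powr_mono')
    have "0 \<le> run_const * ln (real (Suc i))" using run_const_pos by simp
    then show "real (run_length i) \<le> 1 * run_const * ln (real (Suc i))"
      unfolding run_length_def by linarith
  qed (use p in auto)
  also have "\<dots> = p ^ run_length i" using p by (simp add: powr_realpow)
  finally show ?thesis unfolding eq by (rule mult_left_mono) simp
qed

text \<open>Patterns in disjoint blocks depend on disjoint sets of coordinates, hence are
  independent, and their probabilities dominate a multiple of the harmonic series.\<close>

lemma AE_carry_pattern: "AE w in bernoulli. \<exists>\<^sub>\<infinity>i. carry_pattern (\<lambda>t. snd (w t)) i"
proof (rule B.P.AE_infinitely_often)
  let ?K = "\<lambda>i. {block_start i..block_start i + run_length i}"
  have "B.P.indep_vars (\<lambda>_. uniform_count_measure D) (\<lambda>t w. w t) UNIV"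
    by (rule B.indep_vars_component) (rule refl)
  then have ind: "B.P.indep_vars (\<lambda>i. PiM (?K i) (\<lambda>_. uniform_count_measure D)) (\<lambda>i w. restrict (\<lambda>t. w t) (?K i)) UNIV"
    by (rule B.P.indep_vars_restrict) (use disjoint_blocks in auto)
  have "B.P.indep_vars (\<lambda>i. count_space UNIV) (\<lambda>i w. carry_pattern (\<lambda>t. snd (restrict (\<lambda>t. w t) (?K i) t)) i) UNIV"
  proof (rule B.P.indep_vars_compose2[OF ind])
    fix i
    have fin: "finite (?K i)" by simp
    show "(\<lambda>w. carry_pattern (\<lambda>t. snd (w t)) i) \<in> measurable (PiM (?K i) (\<lambda>_. uniform_count_measure D)) (count_space UNIV)"
      unfolding carry_pattern_def
    proof (rule pred_intros_finite(3)[OF fin])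
      fix t assume t: "t \<in> ?K i"
      show "Measurable.pred (PiM (?K i) (\<lambda>_. uniform_count_measure D))
          (\<lambda>w. snd (w t) = (if t = block_start i then Suc j else 0))"
      proof (rule measurable_compose[where f = "\<lambda>w. w t" and N = "uniform_count_measure D"])
        show "(\<lambda>w. w t) \<in> measurable (PiM (?K i) (\<lambda>_. uniform_count_measure D)) (uniform_count_measure D)"
          using t by simp
      qed (auto simp: measurable_def space_uniform_count_measure sets_uniform_count_measure)
    qed
  qed
  moreover have "carry_pattern (\<lambda>t. snd (restrict (\<lambda>t. w t) (?K i) t)) i = carry_pattern (\<lambda>t. snd (w t)) i" for w :: "nat \<Rightarrow> nat \<times> nat" and i
    unfolding carry_pattern_def by (intro ball_cong refl) simp
  ultimately show "B.P.indep_vars (\<lambda>_. count_space UNIV) (\<lambda>i w. carry_pattern (\<lambda>t. snd (w t)) i) UNIV"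
    by (simp only:)
  show "\<not> summable (\<lambda>i. measure bernoulli {w \<in> space bernoulli. carry_pattern (\<lambda>t. snd (w t)) i})"
  proof
    assume "summable (\<lambda>i. measure bernoulli {w \<in> space bernoulli. carry_pattern (\<lambda>t. snd (w t)) i})"
    then have s: "summable (\<lambda>i. measure bernoulli {w \<in> Omega. carry_pattern (\<lambda>t. snd (w t)) i})"
      by (simp only: space_bernoulli)
    let ?c = "real (fiber D (Suc j)) / real (card D)"
    have c: "?c \<noteq> 0" using Suc_j_pos D_nonempty by simp
    have "summable (\<lambda>i. ?c * (1 / real (Suc i)))"
    proof (rule summable_comparison_test'[OF s, of 0])
      fix i
      show "norm (?c * (1 / real (Suc i))) \<le> measure bernoulli {w \<in> Omega. carry_pattern (\<lambda>t. snd (w t)) i}"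
        using prob_carry_pattern_ge[of i] by simp
    qed
    then have "summable (\<lambda>i. 1 / real (Suc i))" using c by (simp only: summable_cmult_iff) simp
    then have "summable (\<lambda>i. 1 / real i)" by (simp only: summable_Suc_iff[of "\<lambda>i. 1 / real i"])
    then have "summable (\<lambda>i. real i powr (- 1))" by (simp add: powr_minus_divide)
    then show False by (subst (asm) summable_real_powr_iff) simp
  qed
qed

text \<open>The margins \<open>1 / Suc e\<close> keep the condition a countable intersection. It
  speaks of a digit sequence and not of \<open>w\<close>, so it can be evaluated on the digits read
  off a point.\<close>

definition typical :: "(nat \<Rightarrow> nat) \<Rightarrow> bool" where
  "typical f \<longleftrightarrow> (\<forall>e :: nat. \<forall>\<^sub>F k in sequentially. run_bound f k ((1 + 1 / real (Suc e)) * run_const * ln (real k)))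
    \<and> (\<exists>\<^sub>\<infinity>i. carry_pattern f i)"

lemma AE_typical: "AE w in bernoulli. typical (\<lambda>t. snd (w t))"
proof -
  have "AE w in bernoulli. \<forall>e :: nat. \<forall>\<^sub>F k in sequentially.
      run_bound (\<lambda>t. snd (w t)) k ((1 + 1 / real (Suc e)) * run_const * ln (real k))"
    unfolding AE_all_countable by (intro allI AE_run_bound) simp
  with AE_carry_pattern show ?thesis unfolding typical_def by eventually_elim blast
qed

end

section \<open>The doubling index of a typical point\<close>

text \<open>Converse to \<open>word_value_Suc_eqD\<close>, for constructing a neighbour across a row
  boundary.\<close>

lemma word_value_carry:
  assumes "\<And>t. t < s \<Longrightarrow> f t = g t" "g s = Suc (f s)" "2 \<le> b"
    and "\<And>t. s < t \<Longrightarrow> t < Suc (s + u) \<Longrightarrow> f t = b - 1 \<and> g t = 0"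
  shows "word_value b g (Suc (s + u)) = Suc (word_value b f (Suc (s + u)))"
  using assms(4)
proof (induction u)
  case 0
  then show ?case using assms(2) word_value_cong[of s f g b, OF assms(1)] by simp
next
  case (Suc u)
  let ?F = "word_value b f (Suc (s + u))"
  have fg: "f (Suc (s + u)) = b - 1" "g (Suc (s + u)) = 0" using Suc.prems[of "Suc (s + u)"] by auto
  have "word_value b g (Suc (s + Suc u)) = b * word_value b g (Suc (s + u)) + g (Suc (s + u))"
    by (simp only: add_Suc_right word_value.simps(2)[of b g "Suc (s + u)"])
  also have "word_value b g (Suc (s + u)) = Suc ?F" using Suc by auto
  also have "b * Suc ?F + g (Suc (s + u)) = Suc (b * ?F + f (Suc (s + u)))"
    using fg assms(3) by simp
  also have "b * ?F + f (Suc (s + u)) = word_value b f (Suc (s + Suc u))"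
    by (simp only: add_Suc_right word_value.simps(2)[of b f "Suc (s + u)"])
  finally show ?case .
qed

lemma expansion_zero: "expansion b (\<lambda>t. 0) = 0"
  by (simp add: expansion_def)

context bedford_mcmullen
begin

text \<open>Keeps quotients of masses and their logarithms away from the default values at
  zero.\<close>

lemma prob_ball_pos:
  assumes "w \<in> Omega" "0 < s"
  shows "0 < measure bernoulli {v \<in> Omega. code v \<in> ball (code w) s}"
proof -
  have "\<exists>k. (1 / real m) ^ k < s / 2" using assms two_le_m by (intro real_arch_pow_inv) auto
  then obtain k where k: "1 / real m ^ k < s / 2" by (auto simp: power_divide)
  have "1 / real n ^ k \<le> 1 / real m ^ k"
    using two_le_m m_less_n by (intro divide_left_mono power_mono mult_pos_pos zero_less_power) auto
  with k have "1 / real m ^ k + 1 / real n ^ k < s" by simp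
  from less_le_trans[OF weight_pos[OF assms(1)] prob_ball_ge[OF assms(1) order_refl this]]
  show ?thesis .
qed

end

section \<open>A light neighbour across a carry\<close>

context gap_carpet
begin

definition gap :: real where
  "gap = real (fiber D 0) / real (fiber D (m - 1))"

lemma gap_gt_1: "1 < gap"
  unfolding gap_def using top_pos top_less by simp

lemma ratio_bound_gap: "ratio_bound gap"
  unfolding ratio_bound_def using gap_gt_1 top_less top_pos by (simp add: gap_def)

text \<open>The condition \<open>l \<le> s\<close> puts the whole carry into the window of
  \<open>weight\<close>, so each of the \<open>q\<close> digits yields a full factor
  \<open>gap\<close>; the digit at \<open>s\<close> costs at most \<open>n\<close>.\<close>

lemma carry_neighbour_ratio:
  assumes w: "w \<in> Omega" and w': "w' \<in> Omega" and s: "l \<le> s"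
    and eq: "\<And>t. t < s \<Longrightarrow> snd (w' t) = snd (w t)"
    and tail: "\<And>t. s < t \<Longrightarrow> t < Suc (s + q) \<Longrightarrow> snd (w t) = 0 \<and> snd (w' t) = m - 1"
  shows "gap ^ q * weight w' (Suc (s + q)) l \<le> real n * weight w (Suc (s + q)) l"
proof -
  let ?k = "Suc (s + q)"
  let ?a = "\<lambda>v t. real (fiber D (snd (v t)))"
  have split: "(\<Prod>t\<in>{l..<?k}. ?a v t) = (\<Prod>t\<in>{l..<s}. ?a v t) * ?a v s * (\<Prod>t\<in>{Suc s..<?k}. ?a v t)" for v
  proof -
    have "(\<Prod>t\<in>{l..<?k}. ?a v t) = (\<Prod>t\<in>{l..<s}. ?a v t) * (\<Prod>t\<in>{s..<?k}. ?a v t)"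
      using s by (intro prod.atLeastLessThan_concat[symmetric]) auto
    also have "(\<Prod>t\<in>{s..<?k}. ?a v t) = ?a v s * (\<Prod>t\<in>{Suc s..<?k}. ?a v t)"
      by (rule prod.atLeast_Suc_lessThan) simp
    finally show ?thesis by (simp only: mult.assoc)
  qed
  have 1: "(\<Prod>t\<in>{Suc s..<?k}. ?a w t) = real (fiber D 0) ^ q"
    using tail by simp
  have 2: "(\<Prod>t\<in>{Suc s..<?k}. ?a w' t) = real (fiber D (m - 1)) ^ q"
    using tail by simp
  have 3: "(\<Prod>t\<in>{l..<s}. ?a w' t) = (\<Prod>t\<in>{l..<s}. ?a w t)"
    using eq by (intro prod.cong) auto
  have 4: "gap ^ q * real (fiber D (m - 1)) ^ q = real (fiber D 0) ^ q"
    unfolding gap_def power_divide using top_pos by simp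
  let ?P = "\<Prod>t\<in>{l..<s}. ?a w t"
  have "?a w' s \<le> real n" using fiber_le by simp
  also have "\<dots> \<le> real n * ?a w s" using fiber_digit_ge_1[OF w, of s] two_le_n by simp
  finally have 5: "?a w' s \<le> real n * ?a w s" .
  have "gap ^ q * (\<Prod>t\<in>{l..<?k}. ?a w' t) = ?P * real (fiber D 0) ^ q * ?a w' s"
    unfolding split 2 3 4[symmetric] by (simp only: ac_simps)
  also have "\<dots> \<le> ?P * real (fiber D 0) ^ q * (real n * ?a w s)"
    using 5 by (intro mult_left_mono mult_nonneg_nonneg prod_nonneg) auto
  also have "\<dots> = real n * (\<Prod>t\<in>{l..<?k}. ?a w t)"
    unfolding split 1 by (simp only: ac_simps)
  finally have "gap ^ q * (\<Prod>t\<in>{l..<?k}. ?a w' t) / real (card D) ^ ?k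
      \<le> real n * (\<Prod>t\<in>{l..<?k}. ?a w t) / real (card D) ^ ?k"
    by (rule divide_right_mono) simp
  then show ?thesis unfolding weight_def by (simp only: times_divide_eq_right)
qed

text \<open>The point \<open>code w\<close> lies at most \<open>m ^ -k\<close> above the boundary of a row of level \<open>k\<close>. The witness
  sits at height \<open>1 - 1 / m\<close> in the row below that boundary: far enough from the boundary for its
  small ball to stay inside that row, and close enough for the small ball to lie in the large one.\<close>

lemma carry_neighbour:
  assumes w: "w \<in> Omega" and k: "k = Suc (s + q)" and l: "Suc l \<le> s"
    and digit: "snd (w s) = Suc j" and zeros: "\<And>t. s < t \<Longrightarrow> t < k \<Longrightarrow> snd (w t) = 0"
    and nl: "1 / real n ^ l < 1 / real m ^ k" "1 / real m ^ k \<le> real n / real n ^ l"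
    and \<rho>: "0 < \<rho>" "\<rho> < 1 / real n ^ 3" and r: "r = 2 / real m ^ k"
  shows "\<exists>w'\<in>Omega. ball (code w') (\<rho> * r) \<subseteq> ball (code w) r \<and>
    gap ^ q / (9 * real n) \<le> measure bernoulli {v \<in> Omega. code v \<in> ball (code w) r}
      / measure bernoulli {v \<in> Omega. code v \<in> ball (code w') (\<rho> * r)}"
proof -
  obtain a where a: "(a, j) \<in> D" using fiber_posD[OF j_pos] by blast
  obtain b where b: "(b, m - 1) \<in> D" using fiber_posD[OF top_pos] by blast
  obtain c where c: "(c, 0) \<in> D" using fiber_posD[of 0] top_less by auto
  \<comment> \<open>The word of level \<open>k\<close> ends at position \<open>k - 1\<close>; the
    additional digit \<open>m - 1\<close> at position \<open>k\<close> and the zeros after it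
    produce the height \<open>1 - 1 / m\<close>. Agreement before \<open>s\<close> keeps the columns
    close.\<close>
  define w' where "w' t = (if t < s then w t else if t = s then (a, j)
    else if t \<le> k then (b, m - 1) else (c, 0))" for t
  have w': "w' \<in> Omega" using OmegaD[OF w] a b c unfolding Omega_def w'_def by auto
  define L where "L = 1 / real m ^ k"
  have L: "0 < L" using two_le_m by (simp add: L_def)
  have mL: "real m ^ k * L = 1" using two_le_m by (simp add: L_def)
  have n3: "3 \<le> real n" using two_le_m m_less_n by simp
  have m2: "2 \<le> real m" using two_le_m by simp
  have lk: "l \<le> k" using l k by simp
  have row: "row w k = Suc (row w' k)"
    unfolding row_def k
    by (rule word_value_carry) (use digit zeros two_le_m in \<open>auto simp: w'_def k\<close>)
  define y where "y v = expansion m (\<lambda>t. snd (v t))" for v :: "nat \<Rightarrow> nat \<times> nat"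
  define x where "x v = expansion n (\<lambda>t. fst (v t))" for v :: "nat \<Rightarrow> nat \<times> nat"
  have yw: "real (row w k) \<le> real m ^ k * y w" "real m ^ k * y w \<le> real (row w k) + 1"
    using expansion_bounds[of m "\<lambda>t. snd (w t)" k, OF two_le_m snd_less[OF w]]
    unfolding y_def row_def by auto
  have "expansion m (\<lambda>t. snd (w' (k + t))) = (real (m - 1) + 0) / real m"
  proof -
    have "expansion m (\<lambda>t. snd (w' (k + t))) = (real (snd (w' (k + 0))) + expansion m (\<lambda>t. snd (w' (k + Suc t)))) / real m"
      by (rule expansion_Suc[OF two_le_m snd_less[OF w']])
    also have "snd (w' (k + 0)) = m - 1" using k by (simp add: w'_def)
    also have "(\<lambda>t. snd (w' (k + Suc t))) = (\<lambda>t. 0)" using k by (simp add: w'_def)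
    finally show ?thesis by (simp only: expansion_zero)
  qed
  also have "\<dots> = 1 - 1 / real m" using two_le_m by (simp add: of_nat_diff field_simps)
  finally have yw': "real m ^ k * y w' = real (row w' k) + (1 - 1 / real m)"
    using expansion_split[of m "\<lambda>t. snd (w' t)" k, OF two_le_m snd_less[OF w']]
    unfolding y_def row_def by simp
  have m1: "1 / real m \<le> 1 / 2" "0 < 1 / real m" using m2 by (auto intro: divide_left_mono)
  \<comment> \<open>In units of \<open>L\<close>, \<open>w\<close> is at most 1 above the boundary
    and \<open>w'\<close> is \<open>1 / m \<le> 1 / 2\<close> below it.\<close>
  have dy: "\<bar>y w - y w'\<bar> \<le> 3 / 2 * L"
  proof -
    have "real m ^ k * (y w - y w') \<le> 3 / 2" "0 \<le> real m ^ k * (y w - y w')"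
      unfolding right_diff_distrib using yw yw' row m1 by linarith+
    then have "L * (real m ^ k * (y w - y w')) \<le> L * (3 / 2)" "0 \<le> L * (real m ^ k * (y w - y w'))"
      using L by (simp_all only: mult_left_mono less_imp_le mult_nonneg_nonneg)
    moreover have "L * (real m ^ k * (y w - y w')) = (real m ^ k * L) * (y w - y w')"
      by (simp only: ac_simps)
    ultimately have "y w - y w' \<le> L * (3 / 2)" "0 \<le> y w - y w'"
      unfolding mL mult_1 by (simp_all only:)
    then show ?thesis by linarith
  qed
  have nlL: "1 / real n ^ l < L" using nl(1) by (simp add: L_def)
  have dx: "\<bar>x w - x w'\<bar> \<le> L / 3"
  proof -
    have "\<bar>x w - x w'\<bar> \<le> 1 / real n ^ s" unfolding x_def
      by (intro expansion_dist_le two_le_n fst_less w w') (simp add: w'_def)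
    also have "\<dots> \<le> 1 / real n ^ Suc l"
      using l n3 by (intro divide_left_mono power_increasing mult_pos_pos zero_less_power) auto
    also have "\<dots> = (1 / real n) * (1 / real n ^ l)" by simp
    also have "\<dots> \<le> (1 / 3) * L"
      using nlL n3 by (intro mult_mono) (auto intro!: divide_left_mono)
    finally show ?thesis by simp
  qed
  have n27: "27 \<le> real n ^ 3" using power_mono[OF n3, of 3] by simp
  have \<rho>27: "\<rho> < 1 / 27"
  proof -
    have "1 / real n ^ 3 \<le> 1 / 27" using n27 n3 by (intro divide_left_mono) auto
    then show ?thesis using \<rho>(2) by linarith
  qed
  have rL: "r = 2 * L" using r by (simp add: L_def)
  have \<rho>r: "\<rho> * r < 2 / 27 * L" unfolding rL using \<rho>27 L by simp
  \<comment> \<open>The radius \<open>2 * L\<close> leaves enough room: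
    \<open>3 / 2 + 1 / 3 + 2 / 27 < 2\<close>.\<close>
  have d: "dist (code w) (code w') + \<rho> * r \<le> r"
    using dist_code_le[of w w'] dx dy \<rho>r L rL unfolding x_def y_def by linarith
  have sub: "ball (code w') (\<rho> * r) \<subseteq> ball (code w) r"
  proof
    fix z assume "z \<in> ball (code w') (\<rho> * r)"
    then have "dist (code w') z < \<rho> * r" by simp
    then show "z \<in> ball (code w) r" using d dist_triangle[of "code w" z "code w'"] by simp
  qed
  have lower: "weight w k l \<le> measure bernoulli {v \<in> Omega. code v \<in> ball (code w) r}"
    by (rule prob_ball_ge[OF w lk]) (use nlL rL in \<open>simp add: L_def\<close>)
  have upper: "measure bernoulli {v \<in> Omega. code v \<in> ball (code w') (\<rho> * r)} \<le> 9 * weight w' k l"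
  proof (rule prob_cover_le[OF _ lk less_imp_le[OF weight_pos[OF w']]])
    fix v assume v: "v \<in> Omega" "code v \<in> ball (code w') (\<rho> * r)"
    have dv: "dist (code w') (code v) < \<rho> * r" using v(2) by simp
    \<comment> \<open>\<open>L\<close> may exceed \<open>n ^ -l\<close> by a factor
      \<open>n\<close>, and \<open>2 * n / n ^ 3 \<le> 1\<close> still confines the small ball to
      neighbouring columns.\<close>
    have "\<rho> * r \<le> 1 / real n ^ l"
    proof -
      have "\<rho> * r \<le> (1 / real n ^ 3) * (2 * (real n / real n ^ l))"
        using \<rho> nl(2) L unfolding r by (intro mult_mono) (auto simp: L_def)
      also have "\<dots> = (2 / (real n)\<^sup>2) * (1 / real n ^ l)"
        using n3 by (simp add: power2_eq_square power3_eq_cube)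
      also have "\<dots> \<le> 1 * (1 / real n ^ l)"
      proof (rule mult_right_mono)
        have "3 * 3 \<le> real n * real n" using n3 by (intro mult_mono) auto
        then show "2 / (real n)\<^sup>2 \<le> 1" by (simp add: power2_eq_square)
      qed simp
      finally show ?thesis by simp
    qed
    then have col: "\<bar>int (column v l) - int (column w' l)\<bar> \<le> 1"
      by (rule column_diff_le[OF w' v(1) dv])
    have "\<bar>y w' - y v\<bar> \<le> dist (code w') (code v)"
      using dist_snd_le[of "code w'" "code v"] by (simp add: code_def y_def dist_real_def)
    then have yv: "\<bar>y w' - y v\<bar> < \<rho> * r" using dv by linarith
    have "real m ^ k * (\<rho> * r) = real m ^ k * L * (2 * \<rho>)" unfolding rL by (simp only: ac_simps)
    then have "real m ^ k * (\<rho> * r) = 2 * \<rho>" unfolding mL by simp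
    moreover have "real m ^ k * \<bar>y w' - y v\<bar> < real m ^ k * (\<rho> * r)"
      using yv two_le_m by (intro mult_strict_left_mono) auto
    moreover have "real m ^ k * \<bar>y w' - y v\<bar> = \<bar>real m ^ k * y w' - real m ^ k * y v\<bar>"
      unfolding right_diff_distrib[symmetric] by (simp add: abs_mult)
    ultimately have "\<bar>real m ^ k * y w' - real m ^ k * y v\<bar> < 2 * \<rho>" by linarith
    \<comment> \<open>In units of \<open>L\<close> the small ball has radius
      \<open>2 * \<rho>\<close>, while \<open>w'\<close> is \<open>1 / m\<close> below the upper
      boundary of its row and at least \<open>1 / 2\<close> above the lower one. So the ball meets
      no other row.\<close>
    moreover have "2 * \<rho> \<le> 1 / real m"
    proof -
      have "2 * real m \<le> 3 * 3 * real n" using m_less_n by simp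
      also have "\<dots> \<le> real n * real n * real n" using n3 by (intro mult_right_mono mult_mono) auto
      finally have "2 * real m \<le> real n ^ 3" by (simp add: power3_eq_cube)
      then have "1 / real n ^ 3 \<le> 1 / (2 * real m)" using m2 n3 by (intro divide_left_mono mult_pos_pos zero_less_power) auto
      then show ?thesis using \<rho>(2) by simp
    qed
    ultimately have "real (row w' k) < real m ^ k * y v" "real m ^ k * y v < real (row w' k) + 1"
      using yw' \<rho>27 m1 by linarith+
    moreover have "real (row v k) \<le> real m ^ k * y v" "real m ^ k * y v \<le> real (row v k) + 1"
      using expansion_bounds[of m "\<lambda>t. snd (v t)" k, OF two_le_m snd_less[OF v(1)]]
      unfolding y_def row_def by auto
    ultimately have "row v k = row w' k" by linarith
    then show "\<bar>int (column v l) - int (column w' l)\<bar> \<le> 1 \<and> \<bar>int (row v k) - int (row w' k)\<bar> \<le> 1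
        \<and> weight v k l \<le> weight w' k l"
      using col weight_row_cong[OF v(1) w', of k l] by simp
  qed simp
  have ratio: "gap ^ q * weight w' k l \<le> real n * weight w k l"
    unfolding k by (rule carry_neighbour_ratio[OF w w']) (use l zeros k in \<open>auto simp: w'_def\<close>)
  let ?B = "measure bernoulli {v \<in> Omega. code v \<in> ball (code w) r}"
  let ?B' = "measure bernoulli {v \<in> Omega. code v \<in> ball (code w') (\<rho> * r)}"
  have pos: "0 < ?B'" using \<rho>(1) rL L by (intro prob_ball_pos w') simp
  have g: "0 \<le> gap ^ q" using gap_gt_1 by simp
  have "gap ^ q * ?B' \<le> gap ^ q * (9 * weight w' k l)" using upper g by (rule mult_left_mono)
  also have "\<dots> \<le> 9 * (real n * weight w k l)" using ratio by simp
  also have "\<dots> \<le> 9 * (real n * ?B)" using lower by (intro mult_left_mono) auto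
  finally have "gap ^ q / (9 * real n) \<le> ?B / ?B'"
    using pos n3 by (simp add: field_simps)
  then show ?thesis using w' sub by blast
qed

section \<open>Upper bound for the index at a typical point\<close>

lemma index_code:
  "upper_doubling_index \<phi> (carpet n m D) (carpet_measure n m D) \<rho> (code w) =
     Limsup (at_right 0) (\<lambda>r.
       SUP z' \<in> {z' \<in> carpet n m D. carpet n m D \<inter> ball z' (\<rho> * r) \<subseteq> carpet n m D \<inter> ball (code w) r}.
         ereal (ln (measure bernoulli {v \<in> Omega. code v \<in> ball (code w) r}
           / measure bernoulli {v \<in> Omega. code v \<in> ball z' (\<rho> * r)}) / \<phi> r))"
  unfolding upper_doubling_index_def by (simp only: measure_carpet_Int borel_open open_ball)

text \<open>The logarithm of the mass ratio is at most a constant plus \<open>a * ln k\<close>, with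
  \<open>a\<close> slightly above the claimed value, and \<open>ln k\<close> is at most
  \<open>ln \<bar>ln r\<bar>\<close> up to a constant. The constants are paid for by the slack
  \<open>\<kappa> + \<epsilon> - a\<close>.\<close>

lemma index_le:
  assumes w: "w \<in> Omega" and ty: "typical (\<lambda>t. snd (w t))" and \<rho>: "0 < \<rho>"
  shows "upper_doubling_index (\<lambda>r. ln \<bar>ln r\<bar>) (carpet n m D) (carpet_measure n m D) \<rho> (code w)
    \<le> ereal (run_const * ln gap)"
proof (rule ereal_le_epsilon2)
  fix \<epsilon> :: real assume \<epsilon>: "0 < \<epsilon>"
  define \<kappa> where "\<kappa> = run_const * ln gap"
  have \<kappa>: "0 < \<kappa>" unfolding \<kappa>_def using run_const_pos gap_gt_1 by simp
  obtain e :: nat where "\<kappa> / \<epsilon> < real e" using reals_Archimedean2 by blast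
  then have "\<kappa> < real (Suc e) * \<epsilon>" using \<epsilon> by (simp add: divide_less_eq algebra_simps)
  define a where "a = (1 + 1 / real (Suc e)) * \<kappa>"
  have "\<kappa> / real (Suc e) < \<epsilon>"
    using \<open>\<kappa> < real (Suc e) * \<epsilon>\<close> by (simp add: divide_less_eq mult.commute)
  moreover have "a = \<kappa> + \<kappa> / real (Suc e)" unfolding a_def by (simp add: distrib_right)
  moreover have "0 < \<kappa> / real (Suc e)" using \<kappa> by simp
  ultimately have a: "0 < a" "a < \<kappa> + \<epsilon>" using \<kappa> by linarith+
  obtain C where C: "1 \<le> C" "\<And>r. 0 < r \<Longrightarrow> r \<le> 1 \<Longrightarrow> \<exists>k l. ball_ratio_bound \<rho> C r k l"
    using prob_ball_ratio_le[OF \<rho>] by blast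
  obtain K where K: "\<And>k. K \<le> k \<Longrightarrow>
      run_bound (\<lambda>t. snd (w t)) k ((1 + 1 / real (Suc e)) * run_const * ln (real k))"
    using ty unfolding typical_def eventually_sequentially by meson
  define B where "B = ln (C * (real n)\<^sup>2) - a * ln (ln (real m))"
  have lnm: "0 < ln (real m)" using two_le_m by simp
  have Lim: "filterlim (\<lambda>r. ln \<bar>ln r\<bar>) at_top (at_right (0::real))" by real_asymp
  have ev: "\<forall>\<^sub>F r in at_right (0::real). max 1 (B / (\<kappa> + \<epsilon> - a)) \<le> ln \<bar>ln r\<bar>"
    using Lim unfolding filterlim_at_top by blast
  \<comment> \<open>Together with \<open>1 / m ^ Suc k < r\<close> this radius forces
    \<open>K < k\<close>, the range where the run bound holds.\<close>
  have small: "\<forall>\<^sub>F r in at_right (0::real). r \<in> {0<..<1 / real m ^ Suc (Suc K)}"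
    by (rule eventually_at_right_real) (use two_le_m in simp)
  show "upper_doubling_index (\<lambda>r. ln \<bar>ln r\<bar>) (carpet n m D) (carpet_measure n m D) \<rho> (code w)
    \<le> ereal (run_const * ln gap) + ereal \<epsilon>"
    unfolding index_code \<kappa>_def[symmetric] plus_ereal.simps
  proof (rule Limsup_bounded)
    from ev small
    show "\<forall>\<^sub>F r in at_right 0. (SUP z' \<in> {z' \<in> carpet n m D. carpet n m D \<inter> ball z' (\<rho> * r) \<subseteq> carpet n m D \<inter> ball (code w) r}.
         ereal (ln (measure bernoulli {v \<in> Omega. code v \<in> ball (code w) r}
           / measure bernoulli {v \<in> Omega. code v \<in> ball z' (\<rho> * r)}) / ln \<bar>ln r\<bar>)) \<le> ereal (\<kappa> + \<epsilon>)"
    proof eventually_elim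
      case (elim r)
      have r: "0 < r" "r < 1 / real m ^ Suc (Suc K)" using elim(2) by auto
      have "1 / real m ^ Suc (Suc K) \<le> 1" using two_le_m by (simp add: divide_le_eq_1 one_le_power del: power_Suc)
      then have r1: "r \<le> 1" using r by linarith
      obtain k l where kl: "ball_ratio_bound \<rho> C r k l" using C(2)[OF r(1) r1] by blast
      then have k: "1 / real m ^ Suc k < r" "r \<le> 1 / real m ^ k" unfolding ball_ratio_bound_def by blast+
      have Kk: "K < k"
      proof (rule ccontr)
        assume "\<not> K < k"
        then have "real m ^ Suc k \<le> real m ^ Suc (Suc K)" using two_le_m by (intro power_increasing) auto
        then have "1 / real m ^ Suc (Suc K) \<le> 1 / real m ^ Suc k"
          using two_le_m by (intro divide_left_mono mult_pos_pos zero_less_power) auto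
        then show False using r(2) k(1) by linarith
      qed
      then have k0: "0 < real k" by simp
      let ?L = "ln \<bar>ln r\<bar>"
      have L: "1 \<le> ?L" "B / (\<kappa> + \<epsilon> - a) \<le> ?L" using elim(1) by auto
      have BL: "B \<le> (\<kappa> + \<epsilon> - a) * ?L" using L(2) a(2) by (simp add: divide_le_eq mult.commute)
      have lnk: "ln (real k) \<le> ?L - ln (ln (real m))"
      proof -
        have "ln r \<le> ln (1 / real m ^ k)" using r(1) k(2) by (intro ln_mono) auto
        also have "\<dots> = - (real k * ln (real m))" using two_le_m by (simp add: ln_div ln_realpow)
        finally have "real k * ln (real m) \<le> \<bar>ln r\<bar>" by linarith
        moreover have km: "0 < real k * ln (real m)" using k0 lnm by simp
        ultimately have "ln (real k * ln (real m)) \<le> ?L" by (intro ln_mono) auto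
        then show ?thesis using k0 lnm by (simp add: ln_mult)
      qed
      define b where "b = (1 + 1 / real (Suc e)) * run_const * ln (real k)"
      have run: "run_bound (\<lambda>t. snd (w t)) k b" unfolding b_def using K[of k] Kk by simp
      have bgap: "b * ln gap = a * ln (real k)" unfolding b_def a_def \<kappa>_def by simp
      show ?case
      proof (rule SUP_least)
        fix z' assume "z' \<in> {z' \<in> carpet n m D. carpet n m D \<inter> ball z' (\<rho> * r) \<subseteq> carpet n m D \<inter> ball (code w) r}"
        then have z': "z' \<in> carpet n m D" "carpet n m D \<inter> ball z' (\<rho> * r) \<subseteq> ball (code w) r" by auto
        obtain w' where w': "w' \<in> Omega" "z' = code w'" using z'(1) unfolding carpet_eq by blast
        have "z' \<in> ball z' (\<rho> * r)" using \<rho> r(1) by simp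
        then have d: "dist (code w) (code w') < r" using z' w'(2) by auto
        have adj: "\<bar>int (row w' k) - int (row w k)\<bar> \<le> 1" by (rule row_diff_le[OF w w'(1) d k(2)])
        let ?P = "measure bernoulli {v \<in> Omega. code v \<in> ball (code w) r}"
        let ?P' = "measure bernoulli {v \<in> Omega. code v \<in> ball (code w') (\<rho> * r)}"
        have P: "0 < ?P" by (rule prob_ball_pos[OF w r(1)])
        have P': "0 < ?P'" using \<rho> r(1) by (intro prob_ball_pos[OF w'(1)]) simp
        have "\<forall>v\<in>Omega. \<bar>int (row v k) - int (row w k)\<bar> \<le> 1 \<longrightarrow> weight v k l \<le> ((real n)\<^sup>2 * gap powr b) * weight w' k l"
          using weight_compare[OF _ _ w'(1) adj w ratio_bound_gap run] by blast
        moreover have "0 \<le> (real n)\<^sup>2 * gap powr b" by simp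
        ultimately have "?P \<le> C * ((real n)\<^sup>2 * gap powr b) * ?P'"
          using kl w w'(1) unfolding ball_ratio_bound_def by blast
        then have "?P / ?P' \<le> C * (real n)\<^sup>2 * gap powr b" using P' by (simp add: divide_le_eq mult.assoc)
        then have "ln (?P / ?P') \<le> ln (C * (real n)\<^sup>2 * gap powr b)"
          using P P' by (intro ln_mono) auto
        also have "\<dots> = ln (C * (real n)\<^sup>2) + b * ln gap"
          using C(1) two_le_n gap_gt_1 by (subst ln_mult) (auto simp: ln_powr)
        also have "\<dots> = ln (C * (real n)\<^sup>2) + a * ln (real k)" by (simp only: bgap)
        also have "\<dots> \<le> ln (C * (real n)\<^sup>2) + a * (?L - ln (ln (real m)))"
          using lnk a(1) by (intro add_left_mono mult_left_mono) auto
        also have "\<dots> = B + a * ?L" unfolding B_def by (simp add: algebra_simps)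
        also have "\<dots> \<le> (\<kappa> + \<epsilon> - a) * ?L + a * ?L" using BL by (rule add_right_mono)
        also have "\<dots> = (\<kappa> + \<epsilon>) * ?L" by (simp add: algebra_simps)
        finally have "ln (?P / ?P') / ?L \<le> \<kappa> + \<epsilon>" using L(1) by (simp add: divide_le_eq)
        then show "ereal (ln (?P / measure bernoulli {v \<in> Omega. code v \<in> ball z' (\<rho> * r)}) / ?L) \<le> ereal (\<kappa> + \<epsilon>)"
          unfolding w'(2) by (simp only: ereal_less_eq)
      qed
    qed
  qed
qed

section \<open>Lower bound for the index at a typical point\<close>

lemma carry_pattern_index:
  assumes w: "w \<in> Omega" and pat: "carry_pattern (\<lambda>t. snd (w t)) i"
    and \<rho>: "0 < \<rho>" "\<rho> < 1 / real n ^ 3"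
    and i: "3 * ln (real n) \<le> real (Suc i) * (ln (real n) - ln (real m))"
    and k: "k = Suc i * Suc (run_length i)"
  shows "\<exists>w'\<in>Omega. ball (code w') (\<rho> * (2 / real m ^ k)) \<subseteq> ball (code w) (2 / real m ^ k) \<and>
    gap ^ run_length i / (9 * real n) \<le> measure bernoulli {v \<in> Omega. code v \<in> ball (code w) (2 / real m ^ k)}
      / measure bernoulli {v \<in> Omega. code v \<in> ball (code w') (\<rho> * (2 / real m ^ k))}"
proof -
  let ?s = "block_start i" and ?q = "run_length i"
  have ks: "k = Suc (?s + ?q)" unfolding k block_start_def by simp
  have scale: "0 < 1 / real m ^ k" "1 / real m ^ k \<le> 1" using two_le_m by (auto simp: divide_le_eq_1 one_le_power)
  obtain u where u: "1 / real n ^ Suc u < 1 / real m ^ k" "1 / real m ^ k \<le> 1 / real n ^ u"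
    using ex_power_scale[OF two_le_n scale] .
  have lnn: "0 < ln (real n)" using two_le_n by simp
  have "ln (1 / real m ^ k) \<le> ln (1 / real n ^ u)" using u(2) scale by (intro ln_mono) auto
  then have "real u * ln (real n) \<le> real k * ln (real m)"
    using two_le_m two_le_n by (simp add: ln_div ln_realpow)
  \<comment> \<open>Since \<open>k = Suc i * Suc ?q\<close>, the run is a small part of
    \<open>k\<close> for large \<open>i\<close>. The 3 is what \<open>Suc (Suc u) \<le> ?s\<close>
    requires when \<open>k = Suc (?s + ?q)\<close>, that is, the block starts beyond column level
    \<open>Suc u\<close>.\<close>
  moreover have "(real ?q + 3) * ln (real n) \<le> real k * (ln (real n) - ln (real m))"
  proof -
    have "(real ?q + 3) * ln (real n) \<le> real (Suc ?q) * (3 * ln (real n))"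
      using lnn by (simp add: algebra_simps)
    also have "\<dots> \<le> real (Suc ?q) * (real (Suc i) * (ln (real n) - ln (real m)))"
      using i by (rule mult_left_mono) simp
    also have "\<dots> = real k * (ln (real n) - ln (real m))" unfolding k by (simp only: of_nat_mult ac_simps)
    finally show ?thesis .
  qed
  ultimately have "(real u + real ?q + 3) * ln (real n) \<le> real k * ln (real n)"
    by (simp add: algebra_simps)
  then have "real u + real ?q + 3 \<le> real k" using lnn by simp
  then have l: "Suc (Suc u) \<le> ?s" using ks by linarith
  have 1: "snd (w ?s) = Suc j" using pat unfolding carry_pattern_def by simp
  have 2: "snd (w t) = 0" if "?s < t" "t < k" for t
    using pat that ks unfolding carry_pattern_def by auto
  have 3: "1 / real m ^ k \<le> real n / real n ^ Suc u" using u(2) two_le_n by simp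
  show ?thesis
    by (rule carry_neighbour[OF w ks l 1 2 u(1) 3 \<rho> refl])
qed

text \<open>If the index were smaller, some \<open>y\<close> below the claimed value would bound the
  supremum at all small radii. Every late occurrence of the pattern violates this bound, yet the
  pattern recurs infinitely often.\<close>

lemma index_ge:
  assumes w: "w \<in> Omega" and ty: "typical (\<lambda>t. snd (w t))" and \<rho>: "0 < \<rho>" "\<rho> < 1 / real n ^ 3"
  shows "ereal (run_const * ln gap)
    \<le> upper_doubling_index (\<lambda>r. ln \<bar>ln r\<bar>) (carpet n m D) (carpet_measure n m D) \<rho> (code w)"
proof (rule ccontr)
  assume "\<not> ?thesis"
  then have "upper_doubling_index (\<lambda>r. ln \<bar>ln r\<bar>) (carpet n m D) (carpet_measure n m D) \<rho> (code w)
      < ereal (run_const * ln gap)" by simp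
  then obtain y where y: "upper_doubling_index (\<lambda>r. ln \<bar>ln r\<bar>) (carpet n m D) (carpet_measure n m D) \<rho> (code w)
      < ereal y" "ereal y < ereal (run_const * ln gap)"
    using ereal_dense2 by blast
  define F where "F r = (SUP z' \<in> {z' \<in> carpet n m D. carpet n m D \<inter> ball z' (\<rho> * r) \<subseteq> carpet n m D \<inter> ball (code w) r}.
         ereal (ln (measure bernoulli {v \<in> Omega. code v \<in> ball (code w) r}
           / measure bernoulli {v \<in> Omega. code v \<in> ball z' (\<rho> * r)}) / ln \<bar>ln r\<bar>))" for r
  have "\<forall>\<^sub>F r in at_right 0. F r < ereal y"
    using Limsup_lessD[OF y(1)[unfolded index_code]] unfolding F_def .
  then obtain \<delta> where \<delta>: "0 < \<delta>" "\<And>r. 0 < r \<Longrightarrow> r < \<delta> \<Longrightarrow> F r < ereal y"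
    unfolding eventually_at_right_field by blast
  define k where "k i = Suc i * Suc (run_length i)" for i
  \<comment> \<open>An explicit lower estimate of the quotient at block \<open>i\<close>: the
    \<open>- 1\<close> is the loss from the floor in \<open>run_length\<close>, and the denominator
    bounds \<open>ln \<bar>ln r\<bar>\<close> from above. Only \<open>ln i\<close> survives in the
    limit, on both sides.\<close>
  define g where "g i = ((run_const * ln (real (Suc i)) - 1) * ln gap - ln (9 * real n))
    / ln (real (Suc i) * (run_const * ln (real (Suc i)) + 1) * ln (real m))" for i
  have lnm: "0 < ln (real m)" and lngap: "0 < ln gap" using two_le_m gap_gt_1 by auto
  have nm: "0 < ln (real n) - ln (real m)" using m_less_n two_le_m by simp
  have "g \<longlonglongrightarrow> run_const * ln gap"
    unfolding g_def using run_const_pos lnm lngap by real_asymp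
  then have ev1: "\<forall>\<^sub>F i in sequentially. y < g i" using y(2) by (intro order_tendstoD(1)) auto
  have ev2: "\<forall>\<^sub>F i in sequentially. 2 / real m ^ i < \<delta>"
    by (rule order_tendstoD(2)[OF tendsto_geometric_m \<delta>(1)])
  have ev3: "\<forall>\<^sub>F i in sequentially. 3 * ln (real n) \<le> real (Suc i) * (ln (real n) - ln (real m))"
    using nm by real_asymp
  \<comment> \<open>Enlarging the denominator decreases a quotient only if the numerator is
    nonnegative.\<close>
  have ev4: "\<forall>\<^sub>F i in sequentially. 0 \<le> (run_const * ln (real (Suc i)) - 1) * ln gap - ln (9 * real n)"
    using run_const_pos lngap by real_asymp
  have ev5: "\<forall>\<^sub>F i in sequentially. 1 < real (Suc i) * ln (real m) - ln 2"
    using lnm by real_asymp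
  from ev1 ev2 ev3 ev4 ev5
  have ev: "\<forall>\<^sub>F i in sequentially. \<not> carry_pattern (\<lambda>t. snd (w t)) i"
  proof eventually_elim
    case (elim i)
    show ?case
    proof
      assume pat: "carry_pattern (\<lambda>t. snd (w t)) i"
      define r where "r = 2 / real m ^ k i"
      have ik: "Suc i \<le> k i" unfolding k_def by simp
      have r0: "0 < r" unfolding r_def using two_le_m by simp
      have "r \<le> 2 / real m ^ i" unfolding r_def
        using two_le_m ik by (intro divide_left_mono power_increasing mult_pos_pos zero_less_power) auto
      then have "F r < ereal y" using elim(2) r0 by (intro \<delta>(2)) auto
      obtain w' where w': "w' \<in> Omega" "ball (code w') (\<rho> * r) \<subseteq> ball (code w) r"
        "gap ^ run_length i / (9 * real n) \<le> measure bernoulli {v \<in> Omega. code v \<in> ball (code w) r}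
          / measure bernoulli {v \<in> Omega. code v \<in> ball (code w') (\<rho> * r)}"
        using carry_pattern_index[OF w pat \<rho> elim(3) k_def] unfolding r_def by blast
      let ?Q = "measure bernoulli {v \<in> Omega. code v \<in> ball (code w) r}
          / measure bernoulli {v \<in> Omega. code v \<in> ball (code w') (\<rho> * r)}"
      have ql: "run_const * ln (real (Suc i)) - 1 \<le> real (run_length i)"
        "real (run_length i) \<le> run_const * ln (real (Suc i))"
      proof -
        have "0 \<le> run_const * ln (real (Suc i))" using run_const_pos by simp
        then show "run_const * ln (real (Suc i)) - 1 \<le> real (run_length i)"
          "real (run_length i) \<le> run_const * ln (real (Suc i))"
          unfolding run_length_def by linarith+
      qed
      have "(run_const * ln (real (Suc i)) - 1) * ln gap - ln (9 * real n)
          \<le> real (run_length i) * ln gap - ln (9 * real n)"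
        using ql(1) lngap by (intro diff_right_mono mult_right_mono) auto
      also have "\<dots> = ln (gap ^ run_length i / (9 * real n))"
        using gap_gt_1 two_le_n by (simp add: ln_div ln_realpow)
      also have "\<dots> \<le> ln ?Q" using w'(3) gap_gt_1 two_le_n by (intro ln_mono) auto
      finally have num: "(run_const * ln (real (Suc i)) - 1) * ln gap - ln (9 * real n) \<le> ln ?Q" .
      have lnr: "\<bar>ln r\<bar> = real (k i) * ln (real m) - ln 2"
      proof -
        have "real (Suc i) * ln (real m) \<le> real (k i) * ln (real m)"
          using ik lnm by (intro mult_right_mono) auto
        moreover have "ln r = ln 2 - real (k i) * ln (real m)"
          unfolding r_def using two_le_m by (simp add: ln_div ln_realpow)
        ultimately show ?thesis using elim(5) by linarith
      qed
      have one: "1 < \<bar>ln r\<bar>"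
      proof -
        have "real (Suc i) * ln (real m) \<le> real (k i) * ln (real m)"
          using ik lnm by (intro mult_right_mono) auto
        then show ?thesis unfolding lnr using elim(5) by linarith
      qed
      then have L0: "0 < ln \<bar>ln r\<bar>" by simp
      have "\<bar>ln r\<bar> \<le> real (k i) * ln (real m)" unfolding lnr by simp
      also have "real (k i) = real (Suc i) * (real (run_length i) + 1)"
        unfolding k_def of_nat_mult by simp
      also have "\<dots> * ln (real m) \<le> real (Suc i) * (run_const * ln (real (Suc i)) + 1) * ln (real m)"
        using ql(2) lnm by (intro mult_right_mono mult_left_mono) auto
      finally have "ln \<bar>ln r\<bar> \<le> ln (real (Suc i) * (run_const * ln (real (Suc i)) + 1) * ln (real m))"
        using one by (intro ln_mono) auto
      then have "g i \<le> ln ?Q / ln \<bar>ln r\<bar>"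
        unfolding g_def using num elim(4) L0 by (intro frac_le) auto
      then have "ereal y < ereal (ln ?Q / ln \<bar>ln r\<bar>)" using elim(1) by simp
      also have "\<dots> \<le> F r"
        unfolding F_def using w'(1,2) by (intro SUP_upper) (auto simp: carpet_eq)
      finally show False using \<open>F r < ereal y\<close> by simp
    qed
  qed
  moreover have "\<exists>\<^sub>\<infinity>i. carry_pattern (\<lambda>t. snd (w t)) i" using ty unfolding typical_def by blast
  ultimately show False by (simp add: frequently_def cofinite_eq_sequentially)
qed

section \<open>From typical sequences to almost every point\<close>

lemma typical_not_eventually_const:
  assumes ty: "typical f" and c: "c = 0 \<or> c = m - 1"
  shows "\<exists>t\<ge>T. f t \<noteq> c"
proof (rule ccontr)
  assume "\<not> ?thesis"
  then have const: "f t = c" if "T \<le> t" for t using that by blast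
  have "\<forall>\<^sub>F k in sequentially. run_bound f k ((1 + 1 / real (Suc 0)) * run_const * ln (real k))"
    using ty unfolding typical_def by blast
  \<comment> \<open>A constant tail from \<open>T\<close> on is a run of length \<open>k - T\<close>
    ending at each \<open>k\<close>, which outgrows any logarithm.\<close>
  moreover have "\<forall>\<^sub>F k in sequentially. (1 + 1 / real (Suc 0)) * run_const * ln (real k) < real k - real T"
    using run_const_pos by real_asymp
  moreover have "\<forall>\<^sub>F k in sequentially. T \<le> k" by (rule eventually_ge_at_top)
  ultimately have "\<forall>\<^sub>F k :: nat in sequentially. False"
  proof eventually_elim
    case (elim k)
    have "\<forall>t\<in>{k - (k - T)..<k}. f t = c" using elim(3) const by auto
    then have "(\<forall>t\<in>{k - (k - T)..<k}. f t = 0) \<or> (\<forall>t\<in>{k - (k - T)..<k}. f t = m - 1)"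
      using c by (metis (no_types, lifting))
    then have "real (k - T) \<le> (1 + 1 / real (Suc 0)) * run_const * ln (real k)"
      by (rule elim(1)[unfolded run_bound_def, rule_format, OF diff_le_self])
    then show False using elim(2,3) by (simp add: of_nat_diff)
  qed
  then show False by simp
qed

text \<open>The coding is not injective, so an almost sure property of \<open>w\<close> need not descend to the
  points \<open>code w\<close>. Typical sequences do not end in zeros or in digits \<open>m - 1\<close>, hence are
  recovered from the point by the measurable digit functions \<open>floor_digit\<close>.\<close>

lemma typical_floor_digit_iff:
  assumes w: "w \<in> Omega"
  shows "typical (floor_digit m (snd (code w))) \<longleftrightarrow> typical (\<lambda>t. snd (w t))"
proof -
  have eq: "floor_digit m (snd (code w)) = (\<lambda>t. snd (w t))" if "\<And>k. \<exists>t\<ge>k. snd (w t) \<noteq> m - 1"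
  proof
    fix t
    show "floor_digit m (snd (code w)) t = snd (w t)" unfolding code_def snd_conv
      by (rule floor_digit_expansion[OF two_le_m snd_less[OF w] that])
  qed
  \<comment> \<open>Here only the digits read off the point are known to be typical. A tail of
    digits \<open>m - 1\<close> in \<open>w\<close> would be read as zeros, and typical digits do
    not end in zeros either.\<close>
  have 1: "\<exists>t\<ge>k. snd (w t) \<noteq> m - 1" if ty: "typical (floor_digit m (snd (code w)))" for k
  proof (rule ccontr)
    assume "\<not> ?thesis"
    then have top: "snd (w t) = m - 1" if "k \<le> t" for t using that by blast
    obtain t where t: "k \<le> t" "floor_digit m (snd (code w)) t \<noteq> 0"
      using typical_not_eventually_const[OF ty disjI1[OF refl]] by blast
    have "floor_digit m (snd (code w)) t = 0" unfolding code_def snd_conv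
      by (rule floor_digit_expansion_top[OF two_le_m snd_less[OF w] top t(1)])
    with t(2) show False by (rule notE)
  qed
  have 2: "\<exists>t\<ge>k. snd (w t) \<noteq> m - 1" if "typical (\<lambda>t. snd (w t))" for k
    by (rule typical_not_eventually_const[OF that]) simp
  show ?thesis
  proof
    assume ty: "typical (floor_digit m (snd (code w)))"
    then show "typical (\<lambda>t. snd (w t))" unfolding eq[OF 1[OF ty]] .
  next
    assume ty: "typical (\<lambda>t. snd (w t))"
    then show "typical (floor_digit m (snd (code w)))" unfolding eq[OF 2[OF ty]] .
  qed
qed

lemma floor_digit_measurable [measurable]:
  "(\<lambda>z :: real \<times> real. floor_digit m (snd z) t) \<in> measurable borel (count_space UNIV)"
proof -
  have "(\<lambda>z :: real \<times> real. real m ^ Suc t * snd z) \<in> borel_measurable borel"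
    by (intro borel_measurable_continuous_onI continuous_intros)
  then have "(\<lambda>z :: real \<times> real. \<lfloor>real m ^ Suc t * snd z\<rfloor>) \<in> measurable borel (count_space UNIV)"
    by (rule measurable_compose[OF _ measurable_real_floor])
  moreover have "(\<lambda>i. nat (i mod int m)) \<in> measurable (count_space UNIV) (count_space UNIV)"
    by simp
  ultimately show ?thesis unfolding floor_digit_def by (rule measurable_compose)
qed

lemma typical_floor_digit_measurable:
  "{z :: real \<times> real. typical (floor_digit m (snd z))} \<in> sets borel"
proof -
  have "Measurable.pred (borel :: (real \<times> real) measure) (\<lambda>z. typical (floor_digit m (snd z)))"
    unfolding typical_def run_bound_def carry_pattern_def eventually_sequentially INFM_nat_le
    by measurable
  then show ?thesis unfolding pred_def by simp
qed

text \<open>The points with typical digits form a Borel set, so the almost sure statement passes to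
  the image measure. Every code of such a point is typical, so any preimage may be used.\<close>

lemma AE_index:
  assumes \<rho>: "0 < \<rho>" "\<rho> < 1 / real n ^ 3"
  shows "AE z\<in>carpet n m D in carpet_measure n m D.
    upper_doubling_index (\<lambda>r. ln \<bar>ln r\<bar>) (carpet n m D) (carpet_measure n m D) \<rho> z
      = ereal (run_const * ln gap)"
proof -
  have "AE w in bernoulli. typical (floor_digit m (snd (code w)))"
    using AE_typical AE_space[of bernoulli]
  proof eventually_elim
    case (elim w)
    then show ?case using typical_floor_digit_iff[of w] by simp
  qed
  then have "AE z in carpet_measure n m D. typical (floor_digit m (snd z))"
    unfolding carpet_measure_eq mu_def
    by (subst AE_distr_iff[OF code_measurable]) (use typical_floor_digit_measurable in simp_all)
  then show ?thesis
  proof eventually_elim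
    case (elim z)
    show ?case
    proof
      assume "z \<in> carpet n m D"
      then obtain w where w: "w \<in> Omega" "z = code w" unfolding carpet_eq by blast
      then have ty: "typical (\<lambda>t. snd (w t))" using elim typical_floor_digit_iff by simp
      show "upper_doubling_index (\<lambda>r. ln \<bar>ln r\<bar>) (carpet n m D) (carpet_measure n m D) \<rho> z
        = ereal (run_const * ln gap)"
        unfolding w(2) using index_le[OF w(1) ty \<rho>(1)] index_ge[OF w(1) ty \<rho>] by (rule antisym)
    qed
  qed
qed

end

theorem theorem5p2:
  fixes n m :: nat and D :: "(nat \<times> nat) set" and \<rho> :: real
  assumes "2 \<le> m" and "m < n"
    and "D \<subseteq> {0..<n} \<times> {0..<m}" and "D \<noteq> {}"
    and "non_doubling_type n m D"
    and "fiber D 0 > fiber D (m - 1)"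
    and "0 < \<rho>" and "\<rho> < 1 / real n ^ 3"
  shows "AE z\<in>carpet n m D in carpet_measure n m D.
           upper_doubling_index (\<lambda>r. ln \<bar>ln r\<bar>) (carpet n m D) (carpet_measure n m D) \<rho> z
           = ereal (- log (real (fiber D 0) / real (card D))
                          (real (fiber D 0) / real (fiber D (m - 1))))"
proof -
  interpret B: bedford_mcmullen n m D by unfold_locales fact+
  obtain j where j: "j < m - 1" "0 < fiber D j" "0 < fiber D (j + 1)"
    using B.non_doubling_typeD(2)[OF assms(5,6)] by blast
  interpret G: gap_carpet n m D j
    by unfold_locales (use B.non_doubling_typeD(1)[OF assms(5,6)] assms(6) j in auto)
  \<comment> \<open>The base of the logarithm in the statement is below 1, whereas
    \<open>run_const\<close> uses the inverse quotient; this accounts for the minus sign.\<close>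
  have "ln (real (fiber D 0) / real (card D)) = - ln (real (card D) / real (fiber D 0))"
    using assms(6) B.card_D_pos by (subst (1 2) ln_div) auto
  then have "- log (real (fiber D 0) / real (card D)) (real (fiber D 0) / real (fiber D (m - 1)))
      = G.run_const * ln G.gap"
    unfolding G.run_const_def G.gap_def log_def by simp
  then show ?thesis using G.AE_index[OF assms(7,8)] by (simp only:)
qed

end
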